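(* Let $V$ be a finitely generated $k\mathfrak{S}_n$-module with canonical decomposition $V\cong\bigoplus_{i=1}^t n_i V_i$, where $V_1,\dots,V_t$ is a complete set of representatives of the isomorphism classes of simple $k\mathfrak{S}_n$-modules and $n_iV_i$ denotes the direct sum of $n_i$ copies of $V_i$. Then $V$ is an $r$-generated $k\mathfrak{S}_n$-module if and only if $n_i\leq r\cdot\dim_k V_i$ for each $i$. In particular, the smallest $r$ such that $V$ is $r$-generated is $$r=\left\lceil\max\left\{\frac{n_i}{\dim_k V_i}\;\middle|\; 1\leq i\leq t\right\}\right\rceil.$$
   Context: $\mathfrak{S}_n$ is the symmetric group on $n$ letters and $k$ is an infinite field with $\operatorname{char}(k)=0$ or $\operatorname{char}(k)>n$ (so $k\mathfrak{S}_n$ is semisimple). A $k\mathfrak{S}_n$-module $M$ is $r$-generated if there exist $f_1,\dots,f_r\in M$ (not necessarily distinct or nonzero) such that $M$ is generated by $f_1,\dots,f_r$ as a $k\mathfrak{S}_n$-module. *)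

theory Defs
  imports "Jordan_Normal_Form.VS_Connect" "HOL-Algebra.Sym_Groups"
begin

hide_const (open) Multiset.mult Polynomial.smult Modules.module Modules.module_hom

section \<open>Left modules over a ring\<close>

text \<open>
  The library locale for modules requires a commutative ring of scalars, which a group algebra is
  not. The following is the same locale over an arbitrary unital ring. As there, the fields
  \<open>mult\<close> and \<open>one\<close> of the record \<open>M\<close> carry no meaning.
\<close>

locale left_module = R?: ring R + M?: abelian_group M
    for R :: "('a, 'c) ring_scheme" and M :: "('a, 'b, 'd) module_scheme" (structure) +
  assumes smult_closed [simp, intro]:
      "\<lbrakk>a \<in> carrier R; x \<in> carrier M\<rbrakk> \<Longrightarrow> a \<odot>\<^bsub>M\<^esub> x \<in> carrier M"
    and smult_l_distr:
      "\<lbrakk>a \<in> carrier R; b \<in> carrier R; x \<in> carrier M\<rbrakk> \<Longrightarrow>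
        (a \<oplus>\<^bsub>R\<^esub> b) \<odot>\<^bsub>M\<^esub> x = a \<odot>\<^bsub>M\<^esub> x \<oplus>\<^bsub>M\<^esub> b \<odot>\<^bsub>M\<^esub> x"
    and smult_r_distr:
      "\<lbrakk>a \<in> carrier R; x \<in> carrier M; y \<in> carrier M\<rbrakk> \<Longrightarrow>
        a \<odot>\<^bsub>M\<^esub> (x \<oplus>\<^bsub>M\<^esub> y) = a \<odot>\<^bsub>M\<^esub> x \<oplus>\<^bsub>M\<^esub> a \<odot>\<^bsub>M\<^esub> y"
    and smult_assoc1:
      "\<lbrakk>a \<in> carrier R; b \<in> carrier R; x \<in> carrier M\<rbrakk> \<Longrightarrow>
        (a \<otimes>\<^bsub>R\<^esub> b) \<odot>\<^bsub>M\<^esub> x = a \<odot>\<^bsub>M\<^esub> (b \<odot>\<^bsub>M\<^esub> x)"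
    and smult_one [simp]:
      "x \<in> carrier M \<Longrightarrow> \<one>\<^bsub>R\<^esub> \<odot>\<^bsub>M\<^esub> x = x"

text \<open>
  \<open>Module.submodule\<close> and \<open>module_hom\<close> do not presuppose commutativity, so they apply to left
  modules as they stand. (The unqualified \<open>submodule\<close> of the vector space library does.)
\<close>

definition module_isomorphic ::
    "('a, 'c) ring_scheme \<Rightarrow> ('a, 'b, 'd) module_scheme \<Rightarrow> ('a, 'e, 'f) module_scheme \<Rightarrow> bool"
  where "module_isomorphic R M N \<longleftrightarrow>
    (\<exists>h \<in> module_hom R M N. bij_betw h (carrier M) (carrier N))"

definition simple_module :: "('a, 'c) ring_scheme \<Rightarrow> ('a, 'b, 'd) module_scheme \<Rightarrow> bool"
  where "simple_module R M \<longleftrightarrow> left_module R M \<and> carrier M \<noteq> {\<zero>\<^bsub>M\<^esub>} \<and>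
    (\<forall>N. Module.submodule N R M \<longrightarrow> N = {\<zero>\<^bsub>M\<^esub>} \<or> N = carrier M)"

definition generated_submodule ::
    "('a, 'c) ring_scheme \<Rightarrow> ('a, 'b, 'd) module_scheme \<Rightarrow> 'b set \<Rightarrow> 'b set"
  where "generated_submodule R M F = \<Inter>{N. Module.submodule N R M \<and> F \<subseteq> N}"

definition finitely_generated :: "('a, 'c) ring_scheme \<Rightarrow> ('a, 'b, 'd) module_scheme \<Rightarrow> bool"
  where "finitely_generated R M \<longleftrightarrow>
    (\<exists>F. finite F \<and> F \<subseteq> carrier M \<and> generated_submodule R M F = carrier M)"

definition r_generated :: "('a, 'c) ring_scheme \<Rightarrow> nat \<Rightarrow> ('a, 'b, 'd) module_scheme \<Rightarrow> bool"
  where "r_generated R r M \<longleftrightarrow>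
    (\<exists>f. (\<forall>i \<in> {1..r}. f i \<in> carrier M) \<and> generated_submodule R M (f ` {1..r}) = carrier M)"

text \<open>For a finite index set, the direct sum is carried by the full product.\<close>

definition direct_sum_family ::
    "'i set \<Rightarrow> ('i \<Rightarrow> ('a, 'b, 'd) module_scheme) \<Rightarrow> ('a, 'i \<Rightarrow> 'b) module"
  where "direct_sum_family I M =
    \<lparr>carrier = (\<Pi>\<^sub>E i\<in>I. carrier (M i)),
     mult = (\<lambda>x y. \<lambda>i\<in>I. \<zero>\<^bsub>M i\<^esub>),
     one = (\<lambda>i\<in>I. \<zero>\<^bsub>M i\<^esub>),
     zero = (\<lambda>i\<in>I. \<zero>\<^bsub>M i\<^esub>),
     add = (\<lambda>x y. \<lambda>i\<in>I. x i \<oplus>\<^bsub>M i\<^esub> y i),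
     smult = (\<lambda>a x. \<lambda>i\<in>I. a \<odot>\<^bsub>M i\<^esub> x i)\<rparr>"

text \<open>The module \<open>m\<^sub>1 S\<^sub>1 \<oplus> \<dots> \<oplus> m\<^sub>t S\<^sub>t\<close>; the pair \<open>(i, j)\<close> indexes the \<open>j\<close>-th copy of \<open>S\<^sub>i\<close>.\<close>

definition isotypic_sum ::
    "nat \<Rightarrow> (nat \<Rightarrow> nat) \<Rightarrow> (nat \<Rightarrow> ('a, 'b, 'd) module_scheme) \<Rightarrow> ('a, nat \<times> nat \<Rightarrow> 'b) module"
  where "isotypic_sum t m S = direct_sum_family (SIGMA i:{1..t}. {1..m i}) (\<lambda>(i, j). S i)"

text \<open>
  A formula cannot quantify over all simple modules of all types. Completeness is therefore
  required for the simple modules whose elements are of the type of the ring elements. This is no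
  restriction: lemma \<open>simple_module_in_ring_type\<close> below shows that every simple module, of whatever
  type, is isomorphic to one of these.
\<close>

definition complete_simple_reps ::
    "('a, 'c) ring_scheme \<Rightarrow> nat \<Rightarrow> (nat \<Rightarrow> ('a, 'b, 'd) module_scheme) \<Rightarrow> bool"
  where "complete_simple_reps R t S \<longleftrightarrow>
    (\<forall>i \<in> {1..t}. simple_module R (S i)) \<and>
    (\<forall>i \<in> {1..t}. \<forall>j \<in> {1..t}. module_isomorphic R (S i) (S j) \<longrightarrow> i = j) \<and>
    (\<forall>M :: ('a, 'a) module. simple_module R M \<longrightarrow> (\<exists>i \<in> {1..t}. module_isomorphic R M (S i)))"


section \<open>The group algebra of a finite group\<close>

text \<open>
  The element \<open>\<Sum>\<^sub>g a\<^sub>g g\<close> is the function \<open>g \<mapsto> a\<^sub>g\<close>, extended by zero outside the carrier of \<open>G\<close>;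
  the product is convolution. Only meaningful for finite \<open>G\<close>, as no finite support is imposed.
\<close>

definition group_algebra :: "('g, 'c) monoid_scheme \<Rightarrow> ('g \<Rightarrow> 'k :: field) ring"
  where "group_algebra G =
    \<lparr>carrier = {a. \<forall>g. g \<notin> carrier G \<longrightarrow> a g = 0},
     mult = (\<lambda>a b g. if g \<in> carrier G then \<Sum>h\<in>carrier G. a h * b (inv\<^bsub>G\<^esub> h \<otimes>\<^bsub>G\<^esub> g) else 0),
     one = (\<lambda>g. if g = \<one>\<^bsub>G\<^esub> then 1 else 0),
     zero = (\<lambda>g. 0),
     add = (\<lambda>a b g. a g + b g)\<rparr>"

text \<open>Restriction of scalars along \<open>k \<rightarrow> kG\<close>, \<open>c \<mapsto> c \<cdot> 1\<close>.\<close>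

definition restrict_scalars ::
    "('g, 'c) monoid_scheme \<Rightarrow> ('g \<Rightarrow> 'k :: field, 'b, 'd) module_scheme \<Rightarrow> ('k, 'b) module"
  where "restrict_scalars G M =
    \<lparr>carrier = carrier M, mult = mult M, one = one M, zero = zero M, add = add M,
     smult = (\<lambda>c x. (\<lambda>g. if g = \<one>\<^bsub>G\<^esub> then c else 0) \<odot>\<^bsub>M\<^esub> x)\<rparr>"

definition module_dim ::
    "('g, 'c) monoid_scheme \<Rightarrow> ('g \<Rightarrow> 'k :: field, 'b, 'd) module_scheme \<Rightarrow> nat"
  where "module_dim G M = vectorspace.dim class_ring (restrict_scalars G M)"


section \<open>Well-definedness\<close>

lemma group_algebra_ring:
  fixes G :: "('g, 'c) monoid_scheme" (structure)
  assumes "group G" "finite (carrier G)"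
  shows "ring (group_algebra G :: ('g \<Rightarrow> 'k :: field) ring)"
proof -
  interpret group G by fact
  let ?R = "group_algebra G :: ('g \<Rightarrow> 'k) ring"
  have reindex: "(\<Sum>h\<in>carrier G. F (inv x \<otimes> h)) = (\<Sum>y\<in>carrier G. F y)"
    if x: "x \<in> carrier G" for x and F :: "'g \<Rightarrow> 'k"
  proof (rule sum.reindex_bij_witness[of _ "\<lambda>y. x \<otimes> y" "\<lambda>h. inv x \<otimes> h"])
  qed (use x in \<open>simp_all add: m_assoc[symmetric]\<close>)
  have assoc: "(a \<otimes>\<^bsub>?R\<^esub> b) \<otimes>\<^bsub>?R\<^esub> c = a \<otimes>\<^bsub>?R\<^esub> (b \<otimes>\<^bsub>?R\<^esub> c)" for a b c
  proof
    fix g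
    show "((a \<otimes>\<^bsub>?R\<^esub> b) \<otimes>\<^bsub>?R\<^esub> c) g = (a \<otimes>\<^bsub>?R\<^esub> (b \<otimes>\<^bsub>?R\<^esub> c)) g"
    proof (cases "g \<in> carrier G")
      case g: True
      have "((a \<otimes>\<^bsub>?R\<^esub> b) \<otimes>\<^bsub>?R\<^esub> c) g =
          (\<Sum>h\<in>carrier G. \<Sum>x\<in>carrier G. a x * b (inv x \<otimes> h) * c (inv h \<otimes> g))"
        using g by (simp add: group_algebra_def sum_distrib_right)
      also have "\<dots> = (\<Sum>x\<in>carrier G. \<Sum>h\<in>carrier G. a x * b (inv x \<otimes> h) * c (inv h \<otimes> g))"
        by (rule sum.swap)
      also have "\<dots> = (\<Sum>x\<in>carrier G. a x * (\<Sum>y\<in>carrier G. b y * c (inv y \<otimes> (inv x \<otimes> g))))"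
      proof (rule sum.cong[OF refl])
        fix x assume x: "x \<in> carrier G"
        have "(\<Sum>h\<in>carrier G. a x * b (inv x \<otimes> h) * c (inv h \<otimes> g)) =
            (\<Sum>h\<in>carrier G. a x * (b (inv x \<otimes> h) * c (inv (inv x \<otimes> h) \<otimes> (inv x \<otimes> g))))"
        proof (rule sum.cong[OF refl])
          fix h assume h: "h \<in> carrier G"
          have "inv (inv x \<otimes> h) \<otimes> (inv x \<otimes> g) = inv h \<otimes> (x \<otimes> (inv x \<otimes> g))"
            using x h g by (simp add: inv_mult_group m_assoc)
          also have "\<dots> = inv h \<otimes> g"
            using x g by (simp add: m_assoc[symmetric])
          finally show "a x * b (inv x \<otimes> h) * c (inv h \<otimes> g) =
              a x * (b (inv x \<otimes> h) * c (inv (inv x \<otimes> h) \<otimes> (inv x \<otimes> g)))"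
            by (simp add: mult.assoc)
        qed
        also have "\<dots> = (\<Sum>y\<in>carrier G. a x * (b y * c (inv y \<otimes> (inv x \<otimes> g))))"
          by (rule reindex[OF x, of "\<lambda>y. a x * (b y * c (inv y \<otimes> (inv x \<otimes> g)))"])
        finally show "(\<Sum>h\<in>carrier G. a x * b (inv x \<otimes> h) * c (inv h \<otimes> g)) =
            a x * (\<Sum>y\<in>carrier G. b y * c (inv y \<otimes> (inv x \<otimes> g)))"
          by (simp add: sum_distrib_left)
      qed
      also have "\<dots> = (a \<otimes>\<^bsub>?R\<^esub> (b \<otimes>\<^bsub>?R\<^esub> c)) g"
        using g by (simp add: group_algebra_def)
      finally show ?thesis .
    qed (simp add: group_algebra_def)
  qed
  have l_one: "\<one>\<^bsub>?R\<^esub> \<otimes>\<^bsub>?R\<^esub> a = a" if "a \<in> carrier ?R" for a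
  proof
    fix g
    have "(\<Sum>h\<in>carrier G. (if h = \<one> then 1 else 0) * a (inv h \<otimes> g)) =
        (\<Sum>h\<in>carrier G. if h = \<one> then a (inv h \<otimes> g) else 0)"
      by (rule sum.cong) auto
    then show "(\<one>\<^bsub>?R\<^esub> \<otimes>\<^bsub>?R\<^esub> a) g = a g"
      using that assms(2) by (auto simp: group_algebra_def)
  qed
  have r_one: "a \<otimes>\<^bsub>?R\<^esub> \<one>\<^bsub>?R\<^esub> = a" if "a \<in> carrier ?R" for a
  proof
    fix g
    have "(\<Sum>h\<in>carrier G. a h * (if inv h \<otimes> g = \<one> then 1 else 0)) =
        (\<Sum>h\<in>carrier G. if h = g then a h else 0)" if g: "g \<in> carrier G"
    proof (rule sum.cong[OF refl])
      fix h assume h: "h \<in> carrier G"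
      then have "inv h \<otimes> g = \<one> \<longleftrightarrow> h = g"
        using g by (metis inv_closed inv_inv inv_equality l_inv)
      then show "a h * (if inv h \<otimes> g = \<one> then 1 else 0) = (if h = g then a h else 0)"
        by simp
    qed
    then show "(a \<otimes>\<^bsub>?R\<^esub> \<one>\<^bsub>?R\<^esub>) g = a g"
      using that assms(2) by (auto simp: group_algebra_def)
  qed
  show ?thesis
  proof (rule ringI)
    show "abelian_group ?R"
    proof (rule abelian_groupI)
      fix a assume "a \<in> carrier ?R"
      then show "\<exists>b\<in>carrier ?R. b \<oplus>\<^bsub>?R\<^esub> a = \<zero>\<^bsub>?R\<^esub>"
        by (intro bexI[of _ "\<lambda>g. - a g"]) (auto simp: group_algebra_def)
    qed (auto simp: group_algebra_def add_ac)
    show "Group.monoid ?R"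
    proof (rule monoidI)
      show "a \<otimes>\<^bsub>?R\<^esub> b \<in> carrier ?R" for a b
        by (simp add: group_algebra_def)
      show "\<one>\<^bsub>?R\<^esub> \<in> carrier ?R"
        by (auto simp: group_algebra_def)
    qed (rule assoc l_one r_one, assumption?)+
  qed (auto simp: group_algebra_def algebra_simps sum.distrib)
qed

lemma restrict_scalars_vectorspace:
  fixes G :: "('g, 'c) monoid_scheme" (structure)
  assumes "group G" "finite (carrier G)"
    and "left_module (group_algebra G :: ('g \<Rightarrow> 'k :: field) ring) M"
  shows "vectorspace (class_ring :: 'k ring) (restrict_scalars G M)"
proof -
  let ?R = "group_algebra G :: ('g \<Rightarrow> 'k) ring"
  interpret group G by fact
  interpret L: left_module ?R M by fact
  define \<iota> where "\<iota> c = (\<lambda>g. if g = \<one> then c else 0)" for c :: 'k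
  have \<iota>: "\<iota> c \<in> carrier ?R" for c
    by (auto simp: group_algebra_def \<iota>_def)
  have \<iota>_add: "\<iota> (c + d) = \<iota> c \<oplus>\<^bsub>?R\<^esub> \<iota> d" for c d
    by (auto simp: group_algebra_def \<iota>_def)
  have \<iota>_one: "\<iota> 1 = \<one>\<^bsub>?R\<^esub>"
    by (auto simp: group_algebra_def \<iota>_def)
  have \<iota>_mult: "\<iota> (c * d) = \<iota> c \<otimes>\<^bsub>?R\<^esub> \<iota> d" for c d
  proof
    fix g
    have "(\<Sum>h\<in>carrier G. \<iota> c h * \<iota> d (inv h \<otimes> g)) =
        (\<Sum>h\<in>carrier G. if h = \<one> then c * \<iota> d (inv h \<otimes> g) else 0)"
      by (rule sum.cong) (auto simp: \<iota>_def)
    then show "\<iota> (c * d) g = (\<iota> c \<otimes>\<^bsub>?R\<^esub> \<iota> d) g"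
      using assms(2) by (auto simp: group_algebra_def \<iota>_def)
  qed
  have smult: "c \<odot>\<^bsub>restrict_scalars G M\<^esub> x = \<iota> c \<odot>\<^bsub>M\<^esub> x" for c x
    by (simp add: restrict_scalars_def \<iota>_def)
  have sel: "carrier (restrict_scalars G M) = carrier M" "add (restrict_scalars G M) = add M"
      "zero (restrict_scalars G M) = zero M"
    by (simp_all add: restrict_scalars_def)
  have "abelian_group (restrict_scalars G M)"
    by (rule abelian_groupI) (auto simp: sel L.M.a_ac intro: L.M.l_neg)
  then have "module class_ring (restrict_scalars G M)"
    by (intro moduleI)
      (auto simp: sel smult \<iota> \<iota>_add \<iota>_mult \<iota>_one L.smult_l_distr L.smult_r_distr L.smult_assoc1
        intro: class_cring.cring_axioms)
  then show ?thesis
    by (intro vectorspace.intro class_field.field_axioms)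
qed

lemma direct_sum_family_left_module:
  assumes "ring R" "\<And>i. i \<in> I \<Longrightarrow> left_module R (M i)"
  shows "left_module R (direct_sum_family I M)"
proof -
  have ab: "abelian_group (M i)" if "i \<in> I" for i
    using assms(2)[OF that] by (simp add: left_module_def)
  have "abelian_group (direct_sum_family I M)"
  proof (rule abelian_groupI)
    fix x assume x: "x \<in> carrier (direct_sum_family I M)"
    show "\<exists>y\<in>carrier (direct_sum_family I M).
        y \<oplus>\<^bsub>direct_sum_family I M\<^esub> x = \<zero>\<^bsub>direct_sum_family I M\<^esub>"
      using x ab
      by (intro bexI[of _ "\<lambda>i\<in>I. \<ominus>\<^bsub>M i\<^esub> x i"])
        (auto simp: direct_sum_family_def PiE_iff abelian_group.a_inv_closed abelian_group.l_neg)
  qed (use ab in \<open>auto simp: direct_sum_family_def PiE_iff abelian_group.axioms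
        abelian_monoid.a_closed abelian_monoid.zero_closed abelian_monoid.a_assoc
        abelian_monoid.a_comm abelian_monoid.a_lcomm
        abelian_monoid.l_zero abelian_monoid.r_zero extensional_def fun_eq_iff restrict_def\<close>)
  then show ?thesis
    unfolding left_module_def left_module_axioms_def
    using assms(1)
    by (auto simp: direct_sum_family_def PiE_iff restrict_def extensional_def fun_eq_iff
        left_module.smult_closed[OF assms(2)] left_module.smult_l_distr[OF assms(2)]
        left_module.smult_r_distr[OF assms(2)] left_module.smult_assoc1[OF assms(2)]
        left_module.smult_one[OF assms(2)])
qed

lemma simple_module_in_ring_type:
  fixes R :: "('a, 'c) ring_scheme" and M :: "('a, 'b, 'd) module_scheme"
  assumes "simple_module R M"
  shows "\<exists>N :: ('a, 'a) module. simple_module R N \<and> module_isomorphic R N M"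
proof -
  interpret left_module R M
    using assms by (simp add: simple_module_def)
  have smult_zero: "\<zero>\<^bsub>R\<^esub> \<odot>\<^bsub>M\<^esub> x = \<zero>\<^bsub>M\<^esub>" if x: "x \<in> carrier M" for x
  proof -
    have "\<zero>\<^bsub>R\<^esub> \<odot>\<^bsub>M\<^esub> x \<oplus>\<^bsub>M\<^esub> \<zero>\<^bsub>R\<^esub> \<odot>\<^bsub>M\<^esub> x = \<zero>\<^bsub>R\<^esub> \<odot>\<^bsub>M\<^esub> x"
      using smult_l_distr[of "\<zero>\<^bsub>R\<^esub>" "\<zero>\<^bsub>R\<^esub>" x] x by simp
    then show ?thesis
      using x by (metis M.add.l_cancel_one' R.zero_closed smult_closed)
  qed
  obtain v where v: "v \<in> carrier M" "v \<noteq> \<zero>\<^bsub>M\<^esub>"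
    using assms M.zero_closed unfolding simple_module_def by blast
  define \<phi> where "\<phi> a = a \<odot>\<^bsub>M\<^esub> v" for a
  have \<phi>_closed: "\<phi> a \<in> carrier M" if "a \<in> carrier R" for a
    using that v by (simp add: \<phi>_def)
  have "subgroup (\<phi> ` carrier R) (add_monoid M)"
  proof (rule M.add.subgroupI)
    show "\<ominus>\<^bsub>M\<^esub> x \<in> \<phi> ` carrier R" if x: "x \<in> \<phi> ` carrier R" for x
    proof -
      obtain a where a: "a \<in> carrier R" "x = a \<odot>\<^bsub>M\<^esub> v"
        using x by (auto simp: \<phi>_def)
      have "(\<ominus>\<^bsub>R\<^esub> a) \<odot>\<^bsub>M\<^esub> v \<oplus>\<^bsub>M\<^esub> a \<odot>\<^bsub>M\<^esub> v = \<zero>\<^bsub>M\<^esub>"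
        using a v by (simp add: smult_l_distr[symmetric] R.l_neg smult_zero)
      then have "\<ominus>\<^bsub>M\<^esub> x = (\<ominus>\<^bsub>R\<^esub> a) \<odot>\<^bsub>M\<^esub> v"
        using a v by (intro M.minus_equality) auto
      then show ?thesis
        using a by (auto simp: \<phi>_def)
    qed
    show "x \<oplus>\<^bsub>M\<^esub> y \<in> \<phi> ` carrier R" if "x \<in> \<phi> ` carrier R" "y \<in> \<phi> ` carrier R" for x y
      using that v by (auto simp: \<phi>_def smult_l_distr[symmetric])
  qed (use \<phi>_closed in auto)
  moreover have "a \<odot>\<^bsub>M\<^esub> x \<in> \<phi> ` carrier R" if "a \<in> carrier R" "x \<in> \<phi> ` carrier R" for a x
    using that v by (auto simp: \<phi>_def smult_assoc1[symmetric])
  ultimately have "Module.submodule (\<phi> ` carrier R) R M"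
    by (intro Module.submodule.intro Module.submodule_axioms.intro)
  moreover have "v \<in> \<phi> ` carrier R"
    using v by (auto simp: \<phi>_def intro!: image_eqI[of _ _ "\<one>\<^bsub>R\<^esub>"])
  ultimately have surj: "\<phi> ` carrier R = carrier M"
    using assms v by (auto simp: simple_module_def)
  define s where "s = inv_into (carrier R) \<phi>"
  have s_closed: "s x \<in> carrier R" and \<phi>_s [simp]: "\<phi> (s x) = x" if "x \<in> carrier M" for x
    using that surj by (auto simp: s_def inv_into_into f_inv_into_f)
  define N :: "('a, 'a) module" where "N =
    \<lparr>carrier = s ` carrier M, mult = (\<lambda>a b. s \<zero>\<^bsub>M\<^esub>), one = s \<zero>\<^bsub>M\<^esub>, zero = s \<zero>\<^bsub>M\<^esub>,
     add = (\<lambda>a b. s (\<phi> a \<oplus>\<^bsub>M\<^esub> \<phi> b)), smult = (\<lambda>r a. s (r \<odot>\<^bsub>M\<^esub> \<phi> a))\<rparr>"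
  have N_sel: "carrier N = s ` carrier M" "\<zero>\<^bsub>N\<^esub> = s \<zero>\<^bsub>M\<^esub>"
      "\<And>a b. a \<oplus>\<^bsub>N\<^esub> b = s (\<phi> a \<oplus>\<^bsub>M\<^esub> \<phi> b)" "\<And>r a. r \<odot>\<^bsub>N\<^esub> a = s (r \<odot>\<^bsub>M\<^esub> \<phi> a)"
    by (simp_all add: N_def)
  have "abelian_group N"
  proof (rule abelian_groupI)
    fix a assume "a \<in> carrier N"
    then obtain x where "x \<in> carrier M" "a = s x"
      by (auto simp: N_sel)
    then show "\<exists>b\<in>carrier N. b \<oplus>\<^bsub>N\<^esub> a = \<zero>\<^bsub>N\<^esub>"
      by (intro bexI[of _ "s (\<ominus>\<^bsub>M\<^esub> x)"]) (auto simp: N_sel M.l_neg)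
  qed (auto simp: N_sel M.a_ac)
  then have N: "left_module R N"
    by (intro left_module.intro left_module_axioms.intro)
      (auto simp: N_sel smult_l_distr smult_r_distr smult_assoc1 intro: R.ring_axioms)
  have inj: "inj_on \<phi> (carrier N)"
    by (auto simp: N_sel inj_on_def)
  have bij: "bij_betw \<phi> (carrier N) (carrier M)"
    using inj by (auto simp: bij_betw_def N_sel image_image)
  have "\<phi> \<in> module_hom R N M"
    by (auto simp: LinearCombinations.module_hom_def N_sel)
  then have iso: "module_isomorphic R N M"
    using bij by (auto simp: module_isomorphic_def)
  have "K = {\<zero>\<^bsub>N\<^esub>} \<or> K = carrier N" if K: "Module.submodule K R N" for K
  proof -
    interpret NN: left_module R N by (rule N)
    interpret K: Module.submodule K R N by (rule K)
    have KN: "K \<subseteq> carrier N"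
      using K.subset by simp
    have K_add: "a \<oplus>\<^bsub>N\<^esub> b \<in> K" if "a \<in> K" "b \<in> K" for a b
      using K.m_closed that by simp
    have K_zero: "\<zero>\<^bsub>N\<^esub> \<in> K"
      using K.one_closed by simp
    have K_smult: "a \<odot>\<^bsub>N\<^esub> b \<in> K" if "a \<in> carrier R" "b \<in> K" for a b
      using that by (rule K.smult_closed)
    have \<phi>K: "\<phi> ` K \<subseteq> carrier M"
      using KN by (auto simp: N_sel)
    have add: "x \<oplus>\<^bsub>M\<^esub> y \<in> \<phi> ` K" if xy: "x \<in> \<phi> ` K" "y \<in> \<phi> ` K" for x y
    proof -
      obtain a b where ab: "a \<in> K" "b \<in> K" "x = \<phi> a" "y = \<phi> b"
        using xy by auto
      have "\<phi> (a \<oplus>\<^bsub>N\<^esub> b) = x \<oplus>\<^bsub>M\<^esub> y"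
        using ab \<phi>K by (simp add: N_sel image_subset_iff)
      then show ?thesis
        using K_add[OF ab(1,2)] by force
    qed
    have smult: "r \<odot>\<^bsub>M\<^esub> x \<in> \<phi> ` K" if rx: "r \<in> carrier R" "x \<in> \<phi> ` K" for r x
    proof -
      obtain a where a: "a \<in> K" "x = \<phi> a"
        using rx by auto
      have "\<phi> (r \<odot>\<^bsub>N\<^esub> a) = r \<odot>\<^bsub>M\<^esub> x"
        using a rx(1) \<phi>K by (simp add: N_sel image_subset_iff)
      then show ?thesis
        using K_smult[OF rx(1) a(1)] by force
    qed
    have "Module.submodule (\<phi> ` K) R M"
    proof (intro Module.submodule.intro Module.submodule_axioms.intro)
      show "subgroup (\<phi> ` K) (add_monoid M)"
      proof (rule M.add.subgroupI)
        fix x assume x: "x \<in> \<phi> ` K"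
        then have xM: "x \<in> carrier M"
          using \<phi>K by auto
        have "(\<ominus>\<^bsub>R\<^esub> \<one>\<^bsub>R\<^esub>) \<odot>\<^bsub>M\<^esub> x \<oplus>\<^bsub>M\<^esub> x = ((\<ominus>\<^bsub>R\<^esub> \<one>\<^bsub>R\<^esub>) \<oplus>\<^bsub>R\<^esub> \<one>\<^bsub>R\<^esub>) \<odot>\<^bsub>M\<^esub> x"
          using xM by (subst smult_l_distr) auto
        also have "\<dots> = \<zero>\<^bsub>M\<^esub>"
          using xM by (simp add: R.l_neg smult_zero)
        finally have "\<ominus>\<^bsub>M\<^esub> x = (\<ominus>\<^bsub>R\<^esub> \<one>\<^bsub>R\<^esub>) \<odot>\<^bsub>M\<^esub> x"
          using xM by (intro M.minus_equality) auto
        then show "\<ominus>\<^bsub>M\<^esub> x \<in> \<phi> ` K"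
          using smult[OF _ x, of "\<ominus>\<^bsub>R\<^esub> \<one>\<^bsub>R\<^esub>"] by simp
      qed (use \<phi>K K_zero add in auto)
    qed (rule smult)
    then consider "\<phi> ` K = {\<zero>\<^bsub>M\<^esub>}" | "\<phi> ` K = carrier M"
      using assms by (auto simp: simple_module_def)
    then show ?thesis
    proof cases
      case 1
      then have "\<phi> ` K = \<phi> ` {\<zero>\<^bsub>N\<^esub>}"
        by (simp add: N_sel)
      then show ?thesis
        using inj KN K_zero by (metis inj_on_image_eq_iff NN.M.zero_closed empty_subsetI insert_subset)
    next
      case 2
      then have "\<phi> ` K = \<phi> ` carrier N"
        using bij by (simp add: bij_betw_def)
      then show ?thesis
        using inj KN by (simp add: inj_on_image_eq_iff)
    qed
  qed
  moreover have "carrier N \<noteq> {\<zero>\<^bsub>N\<^esub>}"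
  proof
    assume "carrier N = {\<zero>\<^bsub>N\<^esub>}"
    then have "s v = s \<zero>\<^bsub>M\<^esub>"
      using v by (auto simp: N_sel)
    then show False
      using v by (metis M.zero_closed \<phi>_s)
  qed
  ultimately show ?thesis
    using N iso by (auto simp: simple_module_def)
qed

end

theory Submission
  imports Defs
begin

text \<open>
  Let \<open>V = \<Oplus> m\<^sub>i S\<^sub>i\<close> and let \<open>f\<^sub>1, \<dots>, f\<^sub>r\<close> be elements of \<open>V\<close>. For each \<open>i\<close> their components
  form \<open>m\<^sub>i\<close> vectors \<open>(f\<^sub>1(i, j), \<dots>, f\<^sub>r(i, j))\<close> of the space \<open>S\<^sub>i\<^sup>r\<close>, whose dimension is
  \<open>r dim S\<^sub>i\<close>. If the endomorphisms of the \<open>S\<^sub>i\<close> are scalars, the \<open>f\<^sub>q\<close> generate \<open>V\<close> exactly if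
  for each \<open>i\<close> these \<open>m\<^sub>i\<close> vectors are linearly independent over \<open>k\<close>. Indeed, the submodule
  generated by the \<open>f\<^sub>q\<close> is proper if and only if it is killed by a nonzero homomorphism from \<open>V\<close> to
  some \<open>S\<^sub>i\<close> (\<open>simple_summand_complement\<close>), and by Schur's lemma such a homomorphism has the form
  \<open>x \<mapsto> \<Sum>\<^sub>j c\<^sub>j x(i, j)\<close>, a linear relation between the vectors. Hence generators exist if and only
  if \<open>m\<^sub>i \<le> r dim S\<^sub>i\<close> for all \<open>i\<close>; the two implications are
  \<open>generated_imp_multiplicity_le\<close> and \<open>multiplicity_le_imp_generated\<close>.

  The arithmetic of \<open>k\<close> and the symmetric group enter only through the fact that simple modules have
  scalar endomorphisms, that is, that \<open>k\<close> is a splitting field (\<open>endomorphism_scalar\<close>). The proof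
  works inside one simple module \<open>M\<close>. Among all Young subgroups with nonzero fixed vectors in \<open>M\<close>
  take an extremal one, \<open>P\<close>. Extremality yields linear relations (\<open>raising_relation\<close>) that express
  the symmetrization over \<open>P\<close> of every \<open>g w\<close>, with \<open>w\<close> in \<open>M\<^sup>P\<close>, as a multiple of \<open>w\<close>
  (\<open>stab_sum_act_highest\<close>). As \<open>M = kG w\<close>, the space \<open>M\<^sup>P\<close> is a line, every endomorphism
  preserves it, and so every endomorphism is a scalar. The only denominators are positive integers up
  to \<open>n\<close> and the order of \<open>P\<close>, which are invertible under the hypothesis on the characteristic.
\<close>

section \<open>Submodules and homomorphisms\<close>

context left_module
begin

lemma zero_smult: "x \<in> carrier M \<Longrightarrow> \<zero>\<^bsub>R\<^esub> \<odot> x = \<zero>"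
  using smult_l_distr[of "\<zero>\<^bsub>R\<^esub>" "\<zero>\<^bsub>R\<^esub>" x]
  by (metis M.add.l_cancel_one' R.zero_closed R.l_zero smult_closed)

lemma smult_zero: "a \<in> carrier R \<Longrightarrow> a \<odot> \<zero> = \<zero>"
  using smult_r_distr[of a "\<zero>" "\<zero>"]
  by (metis M.add.l_cancel_one' M.zero_closed M.l_zero smult_closed)

lemma minus_one_smult: "x \<in> carrier M \<Longrightarrow> (\<ominus>\<^bsub>R\<^esub> \<one>\<^bsub>R\<^esub>) \<odot> x = \<ominus> x"
proof -
  assume x: "x \<in> carrier M"
  have "(\<ominus>\<^bsub>R\<^esub> \<one>\<^bsub>R\<^esub>) \<odot> x \<oplus> x = ((\<ominus>\<^bsub>R\<^esub> \<one>\<^bsub>R\<^esub>) \<oplus>\<^bsub>R\<^esub> \<one>\<^bsub>R\<^esub>) \<odot> x"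
    using x by (subst smult_l_distr) auto
  also have "\<dots> = \<zero>"
    using x by (simp add: R.l_neg zero_smult)
  finally show ?thesis
    using x by (intro M.minus_equality[symmetric]) auto
qed

lemma smult_finsum:
  assumes "a \<in> carrier R" "f \<in> I \<rightarrow> carrier M"
  shows "a \<odot> (\<Oplus>i\<in>I. f i) = (\<Oplus>i\<in>I. a \<odot> f i)"
  using assms(2)
proof (induction I rule: infinite_finite_induct)
  case (insert i I)
  then show ?case
    using assms(1) by (auto simp: smult_r_distr Pi_iff)
qed (use assms(1) in \<open>simp_all add: smult_zero\<close>)

text \<open>
  Closure under negation is automatic because \<open>- x = (- 1) x\<close>; this turns every later submodule
  proof into four closure conditions.
\<close>

lemma submodule_iff:
  "Module.submodule N R M \<longleftrightarrow> N \<subseteq> carrier M \<and> \<zero> \<in> N \<and>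
    (\<forall>x\<in>N. \<forall>y\<in>N. x \<oplus> y \<in> N) \<and> (\<forall>a\<in>carrier R. \<forall>x\<in>N. a \<odot> x \<in> N)"
proof
  assume "Module.submodule N R M"
  then interpret N: Module.submodule N R M .
  show "N \<subseteq> carrier M \<and> \<zero> \<in> N \<and>
    (\<forall>x\<in>N. \<forall>y\<in>N. x \<oplus> y \<in> N) \<and> (\<forall>a\<in>carrier R. \<forall>x\<in>N. a \<odot> x \<in> N)"
    using N.subset N.m_closed N.one_closed N.smult_closed by simp
next
  assume N: "N \<subseteq> carrier M \<and> \<zero> \<in> N \<and>
    (\<forall>x\<in>N. \<forall>y\<in>N. x \<oplus> y \<in> N) \<and> (\<forall>a\<in>carrier R. \<forall>x\<in>N. a \<odot> x \<in> N)"
  have "\<ominus> x \<in> N" if "x \<in> N" for x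
  proof -
    have "(\<ominus>\<^bsub>R\<^esub> \<one>\<^bsub>R\<^esub>) \<odot> x \<in> N"
      using N that by simp
    moreover have "x \<in> carrier M"
      using N that by auto
    ultimately show ?thesis
      by (simp add: minus_one_smult)
  qed
  then show "Module.submodule N R M"
    using N by (intro Module.submodule.intro Module.submodule_axioms.intro M.add.subgroupI) auto
qed

lemma generated_submodule_eq_carrier_iff:
  assumes "F \<subseteq> carrier M"
  shows "generated_submodule R M F = carrier M \<longleftrightarrow>
    (\<forall>N. Module.submodule N R M \<and> F \<subseteq> N \<longrightarrow> N = carrier M)"
  using assms unfolding generated_submodule_def by (auto simp: submodule_iff)

lemma finsum_mem_submodule:
  assumes "Module.submodule N R M" "f \<in> I \<rightarrow> N"
  shows "(\<Oplus>i\<in>I. f i) \<in> N"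
  using assms(2)
proof (induction I rule: infinite_finite_induct)
  case (insert i I)
  then have "f \<in> I \<rightarrow> carrier M" "f i \<in> carrier M"
    using assms(1) unfolding submodule_iff by auto
  then show ?case
    using insert assms(1) unfolding submodule_iff by auto
qed (use assms(1) in \<open>auto simp: submodule_iff\<close>)

lemma zero_submodule: "Module.submodule {\<zero>} R M"
  by (auto simp: submodule_iff smult_zero)

lemma cyclic_submodule:
  assumes "x \<in> carrier M"
  shows "Module.submodule ((\<lambda>a. a \<odot> x) ` carrier R) R M"
  unfolding submodule_iff
proof (intro conjI ballI)
  show "\<zero> \<in> (\<lambda>a. a \<odot> x) ` carrier R"
    using assms by (auto simp: zero_smult intro!: image_eqI[of _ _ "\<zero>\<^bsub>R\<^esub>"])
qed (use assms in \<open>auto simp: smult_l_distr[symmetric] smult_assoc1[symmetric]\<close>)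

lemma simple_module_cyclic:
  assumes "simple_module R M" "x \<in> carrier M" "x \<noteq> \<zero>" "y \<in> carrier M"
  obtains a where "a \<in> carrier R" "y = a \<odot> x"
proof -
  have "x \<in> (\<lambda>a. a \<odot> x) ` carrier R"
    using assms(2) by (auto intro!: image_eqI[of _ _ "\<one>\<^bsub>R\<^esub>"])
  then have "(\<lambda>a. a \<odot> x) ` carrier R = carrier M"
    using assms cyclic_submodule[OF assms(2)] by (auto simp: simple_module_def)
  then show ?thesis
    using assms(4) that by auto
qed

end

locale left_module_hom = M: left_module R M + N: left_module R N
  for R :: "('a, 'c) ring_scheme" and M :: "('a, 'b, 'd) module_scheme"
    and N :: "('a, 'e, 'f) module_scheme" +
  fixes h
  assumes hom: "h \<in> module_hom R M N"
begin

lemma closed [simp, intro]: "x \<in> carrier M \<Longrightarrow> h x \<in> carrier N"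
  using hom by (auto simp: LinearCombinations.module_hom_def)

lemma add: "x \<in> carrier M \<Longrightarrow> y \<in> carrier M \<Longrightarrow> h (x \<oplus>\<^bsub>M\<^esub> y) = h x \<oplus>\<^bsub>N\<^esub> h y"
  using hom by (auto simp: LinearCombinations.module_hom_def)

lemma smult: "a \<in> carrier R \<Longrightarrow> x \<in> carrier M \<Longrightarrow> h (a \<odot>\<^bsub>M\<^esub> x) = a \<odot>\<^bsub>N\<^esub> h x"
  using hom by (auto simp: LinearCombinations.module_hom_def)

lemma zero: "h \<zero>\<^bsub>M\<^esub> = \<zero>\<^bsub>N\<^esub>"
  using smult[of "\<zero>\<^bsub>R\<^esub>" "\<zero>\<^bsub>M\<^esub>"] by (simp add: M.zero_smult N.zero_smult)

lemma finsum:
  assumes "f \<in> I \<rightarrow> carrier M"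
  shows "h (\<Oplus>\<^bsub>M\<^esub>i\<in>I. f i) = (\<Oplus>\<^bsub>N\<^esub>i\<in>I. h (f i))"
  using assms
  by (induction I rule: infinite_finite_induct) (auto simp: zero add Pi_iff)

lemma vimage_submodule:
  assumes "Module.submodule K R N"
  shows "Module.submodule {x \<in> carrier M. h x \<in> K} R M"
  using assms unfolding M.submodule_iff N.submodule_iff by (auto simp: zero add smult)

lemma image_submodule: "Module.submodule (h ` carrier M) R N"
  unfolding N.submodule_iff
proof (intro conjI ballI)
  show "\<zero>\<^bsub>N\<^esub> \<in> h ` carrier M"
    by (metis M.M.zero_closed image_eqI zero)
qed (auto simp: add[symmetric] smult[symmetric])

lemma kernel_submodule: "Module.submodule {x \<in> carrier M. h x = \<zero>\<^bsub>N\<^esub>} R M"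
  using vimage_submodule[OF N.zero_submodule] by simp

lemma inj_on_if_trivial_kernel:
  assumes "{x \<in> carrier M. h x = \<zero>\<^bsub>N\<^esub>} = {\<zero>\<^bsub>M\<^esub>}"
  shows "inj_on h (carrier M)"
proof (rule inj_onI)
  fix x y assume xy: "x \<in> carrier M" "y \<in> carrier M" "h x = h y"
  have "h (\<ominus>\<^bsub>M\<^esub> y) = \<ominus>\<^bsub>N\<^esub> h y"
    using xy by (simp flip: M.minus_one_smult N.minus_one_smult add: smult)
  then have "h (x \<ominus>\<^bsub>M\<^esub> y) = \<zero>\<^bsub>N\<^esub>"
    using xy by (simp add: M.M.minus_eq add N.M.r_neg)
  then have "x \<ominus>\<^bsub>M\<^esub> y = \<zero>\<^bsub>M\<^esub>"
    using assms xy M.M.minus_closed by blast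
  then show "x = y"
    using xy by simp
qed

text \<open>
  Kernel and image are submodules, hence trivial or everything.
\<close>

lemma schur:
  assumes "simple_module R M" "simple_module R N"
  shows "(\<forall>x\<in>carrier M. h x = \<zero>\<^bsub>N\<^esub>) \<or> bij_betw h (carrier M) (carrier N)"
proof (cases "\<forall>x\<in>carrier M. h x = \<zero>\<^bsub>N\<^esub>")
  case False
  then have "{x \<in> carrier M. h x = \<zero>\<^bsub>N\<^esub>} = {\<zero>\<^bsub>M\<^esub>}"
    using assms(1) kernel_submodule unfolding simple_module_def by blast
  moreover have "h ` carrier M = carrier N"
    using False assms(2) image_submodule unfolding simple_module_def by blast
  ultimately show ?thesis
    using inj_on_if_trivial_kernel by (auto simp: bij_betw_def)
qed auto

text \<open>
  The images of generators generate, since the preimage of a submodule containing them is everything.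
\<close>

lemma surj_r_generated:
  assumes surj: "h ` carrier M = carrier N" and "r_generated R r M"
  shows "r_generated R r N"
proof -
  obtain f where f: "\<forall>i \<in> {1..r}. f i \<in> carrier M"
      "generated_submodule R M (f ` {1..r}) = carrier M"
    using assms(2) by (auto simp: r_generated_def)
  have "K = carrier N" if K: "Module.submodule K R N" "(h \<circ> f) ` {1..r} \<subseteq> K" for K
  proof -
    have "{x \<in> carrier M. h x \<in> K} = carrier M"
    proof -
      have "f ` {1..r} \<subseteq> carrier M"
        using f(1) by auto
      moreover have "f ` {1..r} \<subseteq> {x \<in> carrier M. h x \<in> K}"
        using K f(1) by auto
      ultimately show ?thesis
        using f(2) vimage_submodule[OF K(1)] M.generated_submodule_eq_carrier_iff by blast
    qed
    then have "h ` carrier M \<subseteq> K"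
      by auto
    then show ?thesis
      using surj K(1) by (auto simp: N.submodule_iff)
  qed
  moreover have "(h \<circ> f) ` {1..r} \<subseteq> carrier N"
    using f(1) by auto
  ultimately have "generated_submodule R N ((h \<circ> f) ` {1..r}) = carrier N"
    by (simp add: N.generated_submodule_eq_carrier_iff)
  moreover have "\<forall>i \<in> {1..r}. (h \<circ> f) i \<in> carrier N"
    using f(1) by auto
  ultimately show ?thesis
    unfolding r_generated_def by blast
qed

lemma inverse_hom:
  assumes "bij_betw h (carrier M) (carrier N)"
  shows "left_module_hom R N M (inv_into (carrier M) h)"
proof
  let ?g = "inv_into (carrier M) h"
  have g: "?g y \<in> carrier M" "h (?g y) = y" if "y \<in> carrier N" for y
    using assms that by (auto simp: bij_betw_def inv_into_into f_inv_into_f)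
  have inj: "x = y" if "x \<in> carrier M" "y \<in> carrier M" "h x = h y" for x y
    using assms that by (auto simp: bij_betw_def inj_on_def)
  show "?g \<in> module_hom R N M"
    unfolding LinearCombinations.module_hom_def
  proof (intro CollectI conjI allI impI Pi_I g(1); (elim conjE)?)
    fix x y assume xy: "x \<in> carrier N" "y \<in> carrier N"
    show "?g (x \<oplus>\<^bsub>N\<^esub> y) = ?g x \<oplus>\<^bsub>M\<^esub> ?g y"
      by (rule inj) (use xy in \<open>auto simp: add g\<close>)
  next
    fix a x assume ax: "a \<in> carrier R" "x \<in> carrier N"
    show "?g (a \<odot>\<^bsub>N\<^esub> x) = a \<odot>\<^bsub>M\<^esub> ?g x"
      by (rule inj) (use ax in \<open>auto simp: smult g\<close>)
  qed
qed

end

lemma r_generated_cong: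
  assumes M: "left_module R M" and N: "left_module R N" and iso: "module_isomorphic R M N"
  shows "r_generated R r M \<longleftrightarrow> r_generated R r N"
proof -
  obtain h where h: "h \<in> module_hom R M N" "bij_betw h (carrier M) (carrier N)"
    using iso by (auto simp: module_isomorphic_def)
  interpret h: left_module_hom R M N h
    by (intro left_module_hom.intro left_module_hom_axioms.intro M N h)
  interpret g: left_module_hom R N M "inv_into (carrier M) h"
    by (rule h.inverse_hom[OF h(2)])
  have "inv_into (carrier M) h ` carrier N = carrier M"
    using h(2) by (metis bij_betw_def bij_betw_inv_into)
  then show ?thesis
    using h.surj_r_generated g.surj_r_generated h(2) by (auto simp: bij_betw_def)
qed

section \<open>Modules over a group algebra\<close>

text \<open>
  The element \<open>c g\<close> of the group algebra. A \<open>kG\<close>-module is studied through the two kinds of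
  multiplication that these provide: by group elements, and by scalars \<open>c = c 1\<close>.
\<close>

definition group_algebra_single :: "'g \<Rightarrow> 'k :: zero \<Rightarrow> 'g \<Rightarrow> 'k"
  where "group_algebra_single g c = (\<lambda>h. if h = g then c else 0)"

locale group_algebra_module = G: group G + left_module "group_algebra G" M
  for G :: "('g, 'c) monoid_scheme" and M :: "('g \<Rightarrow> 'k :: field, 'b, 'd) module_scheme" (structure) +
  assumes finite_group: "finite (carrier G)"
begin

abbreviation KG :: "('g \<Rightarrow> 'k) ring" where "KG \<equiv> group_algebra G"

definition act :: "'g \<Rightarrow> 'b \<Rightarrow> 'b"
  where "act g x = group_algebra_single g 1 \<odot> x"

definition scale :: "'k \<Rightarrow> 'b \<Rightarrow> 'b"
  where "scale c x = group_algebra_single \<one>\<^bsub>G\<^esub> c \<odot> x"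

lemma single_closed [simp]: "g \<in> carrier G \<Longrightarrow> group_algebra_single g c \<in> carrier KG"
  by (auto simp: group_algebra_def group_algebra_single_def)

lemma single_add:
  "group_algebra_single g c \<oplus>\<^bsub>KG\<^esub> group_algebra_single g d = group_algebra_single g (c + d)"
  by (auto simp: group_algebra_def group_algebra_single_def)

lemma single_one: "group_algebra_single \<one>\<^bsub>G\<^esub> 1 = \<one>\<^bsub>KG\<^esub>"
  by (auto simp: group_algebra_def group_algebra_single_def)

lemma single_zero: "group_algebra_single g 0 = \<zero>\<^bsub>KG\<^esub>"
  by (auto simp: group_algebra_def group_algebra_single_def)

lemma single_mult:
  assumes g: "g \<in> carrier G" and h: "h \<in> carrier G"
  shows "group_algebra_single g c \<otimes>\<^bsub>KG\<^esub> group_algebra_single h d =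
    group_algebra_single (g \<otimes>\<^bsub>G\<^esub> h) (c * d)"
proof
  fix x
  have "(\<Sum>y\<in>carrier G. group_algebra_single g c y * group_algebra_single h d (inv\<^bsub>G\<^esub> y \<otimes>\<^bsub>G\<^esub> x)) =
      (\<Sum>y\<in>carrier G. if y = g then c * group_algebra_single h d (inv\<^bsub>G\<^esub> g \<otimes>\<^bsub>G\<^esub> x) else 0)"
    by (rule sum.cong) (auto simp: group_algebra_single_def)
  also have "\<dots> = c * group_algebra_single h d (inv\<^bsub>G\<^esub> g \<otimes>\<^bsub>G\<^esub> x)"
    using g finite_group by simp
  finally have sum: "(\<Sum>y\<in>carrier G. group_algebra_single g c y *
      group_algebra_single h d (inv\<^bsub>G\<^esub> y \<otimes>\<^bsub>G\<^esub> x)) = c * group_algebra_single h d (inv\<^bsub>G\<^esub> g \<otimes>\<^bsub>G\<^esub> x)" .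
  have "inv\<^bsub>G\<^esub> g \<otimes>\<^bsub>G\<^esub> x = h \<longleftrightarrow> x = g \<otimes>\<^bsub>G\<^esub> h" if "x \<in> carrier G"
    using g h that G.inv_solve_left' by blast
  then show "(group_algebra_single g c \<otimes>\<^bsub>KG\<^esub> group_algebra_single h d) x =
      group_algebra_single (g \<otimes>\<^bsub>G\<^esub> h) (c * d) x"
    using g h by (auto simp: group_algebra_def sum) (auto simp: group_algebra_single_def)
qed

lemma act_closed [simp]: "g \<in> carrier G \<Longrightarrow> x \<in> carrier M \<Longrightarrow> act g x \<in> carrier M"
  by (simp add: act_def)

lemma scale_closed [simp]: "x \<in> carrier M \<Longrightarrow> scale c x \<in> carrier M"
  by (simp add: scale_def)

lemma scale_add:
  "x \<in> carrier M \<Longrightarrow> y \<in> carrier M \<Longrightarrow> scale c (x \<oplus> y) = scale c x \<oplus> scale c y"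
  by (simp add: scale_def smult_r_distr)

lemma scale_add_left: "x \<in> carrier M \<Longrightarrow> scale (c + d) x = scale c x \<oplus> scale d x"
  by (simp add: scale_def smult_l_distr flip: single_add)

lemma act_one: "x \<in> carrier M \<Longrightarrow> act \<one>\<^bsub>G\<^esub> x = x"
  by (simp add: act_def single_one)

lemma scale_one: "x \<in> carrier M \<Longrightarrow> scale 1 x = x"
  by (simp add: scale_def single_one)

lemma scale_0_left [simp]: "x \<in> carrier M \<Longrightarrow> scale 0 x = \<zero>"
  by (simp add: scale_def single_zero zero_smult)

lemma scale_zero [simp]: "scale c \<zero> = \<zero>"
  by (simp add: scale_def smult_zero)

lemma act_act:
  "g \<in> carrier G \<Longrightarrow> h \<in> carrier G \<Longrightarrow> x \<in> carrier M \<Longrightarrow> act g (act h x) = act (g \<otimes>\<^bsub>G\<^esub> h) x"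
  by (simp add: act_def smult_assoc1[symmetric] single_mult)

lemma scale_scale: "x \<in> carrier M \<Longrightarrow> scale c (scale d x) = scale (c * d) x"
  by (simp add: scale_def smult_assoc1[symmetric] single_mult)

lemma scale_act:
  "g \<in> carrier G \<Longrightarrow> x \<in> carrier M \<Longrightarrow> scale c (act g x) = group_algebra_single g c \<odot> x"
  by (simp add: scale_def act_def smult_assoc1[symmetric] single_mult)

lemma act_scale:
  "g \<in> carrier G \<Longrightarrow> x \<in> carrier M \<Longrightarrow> act g (scale c x) = scale c (act g x)"
  by (simp add: scale_def act_def smult_assoc1[symmetric] single_mult)

lemma scale_minus_one: "x \<in> carrier M \<Longrightarrow> scale (- 1) x = \<ominus> x"
  using scale_add_left[of x "-1" 1] by (simp add: scale_one M.minus_equality)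

lemma scale_eq_zero_iff: "x \<in> carrier M \<Longrightarrow> scale c x = \<zero> \<longleftrightarrow> c = 0 \<or> x = \<zero>"
  by (metis left_inverse scale_0_left scale_one scale_scale scale_zero)

lemma act_finsum:
  "g \<in> carrier G \<Longrightarrow> f \<in> I \<rightarrow> carrier M \<Longrightarrow> act g (\<Oplus>i\<in>I. f i) = (\<Oplus>i\<in>I. act g (f i))"
  by (simp add: act_def smult_finsum)

lemma scale_finsum:
  "f \<in> I \<rightarrow> carrier M \<Longrightarrow> scale c (\<Oplus>i\<in>I. f i) = (\<Oplus>i\<in>I. scale c (f i))"
  by (simp add: scale_def smult_finsum)

lemma scale_sum:
  assumes "x \<in> carrier M"
  shows "scale (\<Sum>i\<in>I. c i) x = (\<Oplus>i\<in>I. scale (c i) x)"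
  by (induction I rule: infinite_finite_induct) (use assms in \<open>auto simp: scale_add_left\<close>)

lemma smult_eq_finsum:
  assumes a: "a \<in> carrier KG" and x: "x \<in> carrier M"
  shows "a \<odot> x = (\<Oplus>g\<in>carrier G. scale (a g) (act g x))"
proof -
  have "(\<lambda>g. if g \<in> H then a g else 0) \<odot> x = (\<Oplus>g\<in>H. scale (a g) (act g x))"
    if "finite H" "H \<subseteq> carrier G" for H
    using that
  proof (induction H rule: finite_induct)
    case empty
    have "(\<lambda>g. 0) = \<zero>\<^bsub>KG\<^esub>"
      by (simp add: group_algebra_def)
    then show ?case
      using x by (simp add: zero_smult)
  next
    case (insert h H)
    have "(\<lambda>g. if g \<in> insert h H then a g else 0) =
        group_algebra_single h (a h) \<oplus>\<^bsub>KG\<^esub> (\<lambda>g. if g \<in> H then a g else 0)"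
      using insert by (auto simp: group_algebra_def group_algebra_single_def)
    moreover have "(\<lambda>g. if g \<in> H then a g else 0) \<in> carrier KG"
      using insert by (auto simp: group_algebra_def)
    moreover have "(\<Oplus>g\<in>insert h H. scale (a g) (act g x)) =
        scale (a h) (act h x) \<oplus> (\<Oplus>g\<in>H. scale (a g) (act g x))"
      using insert x by (intro M.finsum_insert) (auto simp: subset_iff)
    ultimately show ?case
      using insert x by (simp add: smult_l_distr scale_act)
  qed
  moreover have "(\<lambda>g. if g \<in> carrier G then a g else 0) = a"
    using a by (auto simp: group_algebra_def)
  ultimately show ?thesis
    using finite_group by force
qed

text \<open>
  Scalars are central in \<open>kG\<close>, so they act by module endomorphisms; the splitting theorem below says
  that a simple module of the symmetric group has no others.
\<close>

lemma scale_smult: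
  assumes a: "a \<in> carrier KG" and x: "x \<in> carrier M"
  shows "scale c (a \<odot> x) = a \<odot> scale c x"
proof -
  have "scale c (a \<odot> x) = (\<Oplus>g\<in>carrier G. scale c (scale (a g) (act g x)))"
    using x by (simp add: smult_eq_finsum[OF a x] scale_finsum)
  also have "\<dots> = (\<Oplus>g\<in>carrier G. scale (a g) (act g (scale c x)))"
    by (rule M.finsum_cong') (use x in \<open>auto simp: act_scale scale_scale mult.commute\<close>)
  finally show ?thesis
    using a x by (simp add: smult_eq_finsum)
qed

end

context group_algebra_module
begin

text \<open>
  A simple module is cyclic, hence spanned over \<open>k\<close> by the finitely many \<open>g v\<close>. The
  basis is described by finite sums in \<open>M\<close> itself, so that the space over \<open>k\<close> obtained by restriction
  of scalars need not be mentioned again.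
\<close>

lemma simple_module_basis:
  assumes simple: "simple_module KG M"
  obtains B where "finite B" "B \<subseteq> carrier M" "card B = module_dim G M"
    "\<And>x. x \<in> carrier M \<Longrightarrow> \<exists>c. x = (\<Oplus>b\<in>B. scale (c b) b)"
    "\<And>c b. (\<Oplus>b\<in>B. scale (c b) b) = \<zero> \<Longrightarrow> b \<in> B \<Longrightarrow> c b = 0"
proof -
  let ?V = "restrict_scalars G M"
  interpret V: vectorspace "class_ring :: 'k ring" ?V
    by (rule restrict_scalars_vectorspace[OF G.group_axioms finite_group left_module_axioms])
  have sel: "carrier ?V = carrier M" "add ?V = add M" "zero ?V = zero M"
    by (simp_all add: restrict_scalars_def)
  have smult: "c \<odot>\<^bsub>?V\<^esub> x = scale c x" for c x
    by (simp add: restrict_scalars_def scale_def group_algebra_single_def)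
  have finsum: "finsum ?V f A = finsum M f A" for f :: "'b \<Rightarrow> 'b" and A
    by (simp add: finsum_def finprod_def sel)
  have lincomb: "V.lincomb a A = (\<Oplus>b\<in>A. scale (a b) b)" for a A
    by (simp add: V.lincomb_def finsum smult)
  obtain v where v: "v \<in> carrier M" "v \<noteq> \<zero>"
    using simple M.zero_closed unfolding simple_module_def by blast
  let ?A = "(\<lambda>g. act g v) ` carrier G"
  have A: "?A \<subseteq> carrier ?V"
    using v by (auto simp: sel)
  interpret span: submodule "class_ring :: 'k ring" "V.span ?A" ?V
    by (rule V.span_is_submodule[OF A])
  have "x \<in> V.span ?A" if x: "x \<in> carrier M" for x
  proof -
    obtain a where a: "a \<in> carrier KG" "x = a \<odot> v"
      using simple_module_cyclic[OF simple v x] by blast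
    have "(\<Oplus>g\<in>H. scale (a g) (act g v)) \<in> V.span ?A" if "finite H" "H \<subseteq> carrier G" for H
      using that
    proof (induction H rule: finite_induct)
      case empty
      then show ?case
        using span.zero_closed by (simp add: sel)
    next
      case (insert h H)
      have "act h v \<in> V.span ?A"
        using insert V.in_own_span[OF A] by auto
      then have "scale (a h) (act h v) \<in> V.span ?A"
        using span.smult_closed[of "a h" "act h v"] by (simp add: smult)
      moreover have "(\<Oplus>g\<in>insert h H. scale (a g) (act g v)) =
          scale (a h) (act h v) \<oplus> (\<Oplus>g\<in>H. scale (a g) (act g v))"
        using insert v by (intro M.finsum_insert) (auto simp: subset_iff)
      ultimately show ?case
        using insert span.m_closed by (simp add: sel)
    qed
    then show ?thesis
      using a v finite_group by (simp add: smult_eq_finsum)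
  qed
  then have span: "V.span ?A = carrier ?V"
    using span.subset by (auto simp: sel)
  have fin_dim: "V.fin_dim"
    unfolding V.fin_dim_def using A span finite_group by blast
  obtain B where B: "finite B" "V.basis B"
    using V.finite_basis_exists[OF fin_dim] by blast
  show ?thesis
  proof (rule that)
    show "finite B" "B \<subseteq> carrier M" "card B = module_dim G M"
      using B V.dim_basis by (auto simp: V.basis_def sel module_dim_def)
  next
    fix x assume "x \<in> carrier M"
    then have "x \<in> V.span B"
      using B by (simp add: V.basis_def sel)
    then obtain c where "x = V.lincomb c B"
      using V.finite_in_span[of B x] B by (auto simp: V.basis_def)
    then show "\<exists>c. x = (\<Oplus>b\<in>B. scale (c b) b)"
      by (auto simp: lincomb)
  next
    fix c b assume c: "(\<Oplus>b\<in>B. scale (c b) b) = \<zero>" and b: "b \<in> B"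
    have "V.lin_dep B" if "c b \<noteq> 0"
      unfolding V.lin_dep_def
      by (intro exI[of _ B] exI[of _ c] exI[of _ b]) (use B(1) b c that in \<open>simp add: lincomb sel\<close>)
    then show "c b = 0"
      using B by (auto simp: V.basis_def)
  qed
qed

lemma simple_module_dim_pos:
  assumes simple: "simple_module KG M"
  shows "module_dim G M > 0"
proof -
  obtain B where B: "finite B" "card B = module_dim G M"
    "\<And>x. x \<in> carrier M \<Longrightarrow> \<exists>c. x = (\<Oplus>b\<in>B. scale (c b) b)"
    using simple_module_basis[OF simple] by metis
  have "B \<noteq> {}"
  proof
    assume "B = {}"
    then have "carrier M = {\<zero>}"
      using B(3) M.zero_closed by fastforce
    then show False
      using simple by (simp add: simple_module_def)
  qed
  then show ?thesis
    using B by (metis card_gt_0_iff)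
qed

end

section \<open>Weight spaces for the symmetric group\<close>

text \<open>
  The goal is that a simple module \<open>M\<close> of the symmetric group has only scalar endomorphisms. It is
  enough to exhibit a one-dimensional subspace of \<open>M\<close> that every endomorphism preserves. Such a
  subspace is found among the \<open>M\<^sup>P\<close>, where \<open>P\<close> is the stabilizer of a map
  \<open>T : {1..n} \<rightarrow> \<nat>\<close>, read as the distribution of the points over numbered rows. These \<open>P\<close> are
  the Young subgroups, and \<open>M\<^sup>P\<close> is a weight space in the sense of Schur-Weyl duality. Choosing
  \<open>T\<close> with \<open>M\<^sup>P \<noteq> 0\<close> and least \<open>\<Sum>T(x)\<close> makes \<open>M\<^sup>P\<close> a highest weight space: moving a
  point to an earlier row leads to a weight space that vanishes.
\<close>

locale symmetric_group_module = group_algebra_module "sym_group n" M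
  for n :: nat and M :: "((nat \<Rightarrow> nat) \<Rightarrow> 'k :: field, 'b, 'd) module_scheme" (structure) +
  assumes char_zero_or_large: "CHAR('k) = 0 \<or> CHAR('k) > n"
begin

lemma act_id: "x \<in> carrier M \<Longrightarrow> act id x = x"
  using act_one by (simp add: sym_group_one)

lemma act_comp:
  "g permutes {1..n} \<Longrightarrow> h permutes {1..n} \<Longrightarrow> x \<in> carrier M \<Longrightarrow> act g (act h x) = act (g \<circ> h) x"
  using act_act by (simp add: sym_group_carrier sym_group_mult)

lemma act_permutes_closed [simp]: "g permutes {1..n} \<Longrightarrow> x \<in> carrier M \<Longrightarrow> act g x \<in> carrier M"
  by (simp add: sym_group_carrier)

definition stab :: "(nat \<Rightarrow> nat) \<Rightarrow> (nat \<Rightarrow> nat) set"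
  where "stab T = {h. h permutes {1..n} \<and> T \<circ> h = T}"

definition fixed :: "(nat \<Rightarrow> nat) \<Rightarrow> 'b set"
  where "fixed T = {x \<in> carrier M. \<forall>h\<in>stab T. act h x = x}"

text \<open>
  Multiplication by this element of \<open>kG\<close> symmetrizes over the stabilizer. Written as an element of
  the ring, symmetrization inherits its linearity from the module axioms.
\<close>

definition stab_sum :: "(nat \<Rightarrow> nat) \<Rightarrow> (nat \<Rightarrow> nat) \<Rightarrow> 'k"
  where "stab_sum T = (\<lambda>g. if g \<in> stab T then 1 else 0)"

lemma stab_subset: "stab T \<subseteq> carrier (sym_group n)"
  by (auto simp: stab_def sym_group_carrier)

lemma finite_stab: "finite (stab T)"
  using stab_subset finite_group by (rule finite_subset)

lemma subgroup_stab: "subgroup (stab T) (sym_group n)"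
proof (rule G.subgroupI)
  show "stab T \<noteq> {}"
    by (auto simp: stab_def intro!: exI[of _ id] permutes_id)
  show "inv\<^bsub>sym_group n\<^esub> h \<in> stab T" if "h \<in> stab T" for h
  proof -
    have h: "h permutes {1..n}" "T \<circ> h = T"
      using that by (auto simp: stab_def)
    have "T \<circ> inv' h = T \<circ> h \<circ> inv' h"
      by (simp add: h(2))
    also have "\<dots> = T"
      using permutes_inv_o(1)[OF h(1)] by (simp add: comp_assoc)
    finally show ?thesis
      using h by (simp add: stab_def permutes_inv sym_group_inv_equality sym_group_carrier)
  qed
  show "g \<otimes>\<^bsub>sym_group n\<^esub> h \<in> stab T" if "g \<in> stab T" "h \<in> stab T" for g h
    using that by (auto simp: stab_def sym_group_mult permutes_compose comp_assoc[symmetric])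
qed (rule stab_subset)

lemma stab_sum_closed [simp]: "stab_sum T \<in> carrier KG"
  using stab_subset by (auto simp: stab_sum_def group_algebra_def)

lemma stab_sum_smult:
  assumes x: "x \<in> carrier M"
  shows "stab_sum T \<odot> x = (\<Oplus>h\<in>stab T. act h x)"
proof -
  have "stab_sum T \<odot> x = (\<Oplus>g\<in>carrier (sym_group n). scale (stab_sum T g) (act g x))"
    by (rule smult_eq_finsum) (use x in auto)
  also have "\<dots> = (\<Oplus>h\<in>stab T. act h x)"
    using x stab_subset finite_group
    by (intro M.add.finprod_mono_neutral_cong_right)
      (auto simp: stab_sum_def scale_one subset_iff)
  finally show ?thesis .
qed

lemma stab_sum_act:
  assumes x: "x \<in> carrier M" and k: "k \<in> stab T"
  shows "stab_sum T \<odot> act k x = stab_sum T \<odot> x"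
proof -
  have k': "k \<in> carrier (sym_group n)"
    using k stab_subset by auto
  have inj: "inj_on (\<lambda>h. h \<otimes>\<^bsub>sym_group n\<^esub> k) (stab T)"
    by (rule inj_on_subset[OF G.inj_on_multc[OF k'] stab_subset])
  have img: "(\<lambda>h. h \<otimes>\<^bsub>sym_group n\<^esub> k) ` stab T = stab T"
    by (rule endo_inj_surj[OF finite_stab _ inj]) (use k subgroup.m_closed[OF subgroup_stab] in auto)
  have "(\<Oplus>h\<in>stab T. act h (act k x)) = (\<Oplus>h\<in>stab T. act (h \<otimes>\<^bsub>sym_group n\<^esub> k) x)"
    by (rule M.finsum_cong') (use x k' stab_subset in \<open>auto simp: act_act subset_iff\<close>)
  also have "\<dots> = (\<Oplus>h\<in>(\<lambda>h. h \<otimes>\<^bsub>sym_group n\<^esub> k) ` stab T. act h x)"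
    by (rule M.finsum_reindex[symmetric])
      (use inj img x stab_subset in \<open>auto simp: subset_iff\<close>)
  also have "\<dots> = (\<Oplus>h\<in>stab T. act h x)"
    by (simp add: img)
  finally show ?thesis
    using x k' by (simp add: stab_sum_smult)
qed

lemma stab_sum_fixed:
  assumes "x \<in> fixed T"
  shows "stab_sum T \<odot> x = scale (of_nat (card (stab T))) x"
proof -
  have x: "x \<in> carrier M" "\<And>h. h \<in> stab T \<Longrightarrow> act h x = x"
    using assms by (auto simp: fixed_def)
  have "stab_sum T \<odot> x = (\<Oplus>h\<in>stab T. scale 1 x)"
    unfolding stab_sum_smult[OF x(1)] by (rule M.finsum_cong') (use x in \<open>auto simp: scale_one\<close>)
  then show ?thesis
    using x by (simp flip: scale_sum)
qed

lemma of_nat_neq_zero: "0 < k \<Longrightarrow> k \<le> n \<Longrightarrow> (of_nat k :: 'k) \<noteq> 0"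
  using char_zero_or_large by (auto simp: of_nat_eq_0_iff_char_dvd dest: dvd_imp_le)

text \<open>
  The order of the stabilizer divides \<open>n!\<close>, all of whose factors are invertible in \<open>k\<close>.
\<close>

lemma card_stab_neq_zero: "(of_nat (card (stab T)) :: 'k) \<noteq> 0"
proof -
  define i where "i = card (rcosets\<^bsub>sym_group n\<^esub> stab T)"
  have "i * card (stab T) = fact n"
    using G.lagrange[OF subgroup_stab] by (simp add: i_def Coset.order_def sym_group_card_carrier)
  then have "of_nat i * of_nat (card (stab T)) = (of_nat (fact n) :: 'k)"
    by (simp flip: of_nat_mult)
  moreover have "(of_nat (fact n) :: 'k) \<noteq> 0"
    using of_nat_neq_zero by (simp add: fact_prod)
  ultimately show ?thesis
    by auto
qed

text \<open>
  If \<open>g\<close> and \<open>h\<close> give the same translate of \<open>T\<close>, then \<open>h\<^sup>-\<^sup>1 g\<close> stabilizes \<open>T\<close>. Thus the vector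
  \<open>g w\<close> may be thought of as attached to the row distribution \<open>T \<circ> g\<^sup>-\<^sup>1\<close>.
\<close>

lemma act_fixed_cong:
  assumes w: "w \<in> fixed T" and g: "g permutes {1..n}" and h: "h permutes {1..n}"
    and eq: "T \<circ> inv' g = T \<circ> inv' h"
  shows "act g w = act h w"
proof -
  have w': "w \<in> carrier M"
    using w by (simp add: fixed_def)
  have perm: "inv' h \<circ> g permutes {1..n}"
    using g h by (simp add: permutes_compose permutes_inv)
  have "T \<circ> (inv' h \<circ> g) = T \<circ> inv' g \<circ> g"
    by (simp add: eq comp_assoc)
  also have "\<dots> = T"
    using permutes_inv_o(2)[OF g] by (simp add: comp_assoc)
  finally have "inv' h \<circ> g \<in> stab T"
    using perm by (simp add: stab_def)
  then have "act h w = act h (act (inv' h \<circ> g) w)"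
    using w by (simp add: fixed_def)
  also have "\<dots> = act (h \<circ> inv' h \<circ> g) w"
    using act_comp[OF h perm w'] by (simp add: comp_assoc)
  also have "\<dots> = act g w"
    using permutes_inv_o(1)[OF h] by simp
  finally show ?thesis ..
qed

text \<open>
  This is the equation saying that a raising operator kills the highest weight vector \<open>w\<close>. Put
  \<open>u = T \<circ> g\<^sup>-\<^sup>1\<close>, so that \<open>g w\<close> belongs to the row distribution \<open>u\<close>, and move \<open>x\<close> from its row
  \<open>s\<close> to the earlier row \<open>r\<close>, giving \<open>U\<close>. The sum runs over all ways of moving some point \<open>y\<close>
  of row \<open>r\<close> of \<open>U\<close> back to row \<open>s\<close>; the transposition of \<open>x\<close> and \<open>y\<close> realizes this move on
  \<open>u\<close>. The stabilizer of \<open>U\<close> permutes these choices, so the sum is a fixed vector for \<open>U\<close>, and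
  \<open>U\<close> has a smaller sum of row numbers than \<open>T\<close>; so it vanishes by minimality.
\<close>

lemma raising_relation:
  assumes w: "w \<in> fixed T"
    and minimal: "\<And>U x. sum U {1..n} < sum T {1..n} \<Longrightarrow> x \<in> fixed U \<Longrightarrow> x = \<zero>"
    and g: "g permutes {1..n}" and x: "x \<in> {1..n}" and r: "r < (T \<circ> inv' g) x"
  shows "(\<Oplus>y\<in>{y\<in>{1..n}. ((T \<circ> inv' g)(x := r)) y = r}. act (transpose x y \<circ> g) w) = \<zero>"
proof (rule minimal)
  define u where "u = T \<circ> inv' g"
  define U where "U = u(x := r)"
  define Y where "Y = {y\<in>{1..n}. U y = r}"
  have "sum T {1..n} = sum u {1..n}"
    using sum.permute[OF permutes_inv[OF g], of T] by (simp add: u_def)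
  moreover have "sum U {1..n} < sum u {1..n}"
    by (rule sum_strict_mono_ex1) (use x r in \<open>auto simp: U_def u_def\<close>)
  ultimately show "sum ((T \<circ> inv' g)(x := r)) {1..n} < sum T {1..n}"
    by (simp add: U_def u_def)
  have w': "w \<in> carrier M"
    using w by (simp add: fixed_def)
  have perm: "transpose x y \<circ> g permutes {1..n}" if "y \<in> {1..n}" for y
    using permutes_compose[OF g permutes_swap_id] x that by blast
  let ?R = "\<Oplus>y\<in>Y. act (transpose x y \<circ> g) w"
  have "act h ?R = ?R" if h: "h \<in> stab U" for h
  proof -
    have hp: "h permutes {1..n}" and Uh: "\<And>z. U (h z) = U z"
      using h by (auto simp: stab_def fun_eq_iff)
    have hY: "h y \<in> Y" if "y \<in> Y" for y
      using that permutes_in_image[OF hp, of y] Uh by (auto simp: Y_def)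
    have inj: "inj_on h Y"
      using permutes_inj[OF hp] by (rule inj_on_subset) simp
    have img: "h ` Y = Y"
      by (rule endo_inj_surj) (use hY inj in \<open>auto simp: Y_def\<close>)
    have step: "act h (act (transpose x y \<circ> g) w) = act (transpose x (h y) \<circ> g) w" if y: "y \<in> Y" for y
    proof -
      have y': "y \<in> {1..n}" "h y \<in> {1..n}" "U y = r" "U (h y) = r"
        using y hY[OF y] by (auto simp: Y_def)
      \<comment> \<open>exchanging \<open>x\<close> and \<open>z\<close> in \<open>u\<close> leaves \<open>x\<close> in row \<open>r\<close> and puts \<open>z\<close> into row \<open>s = u x\<close>\<close>
      have swap: "u \<circ> transpose x z = U(z := u x)" if "U z = r" for z
        using that by (auto simp: U_def fun_eq_iff transpose_def)
      have "T \<circ> inv' (h \<circ> (transpose x y \<circ> g)) = u \<circ> transpose x y \<circ> inv' h"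
        using hp g by (simp add: o_inv_distrib permutes_bij bij_comp u_def comp_assoc)
      also have "\<dots> = U(y := u x) \<circ> inv' h"
        by (simp add: swap y')
      also have "\<dots> = U(h y := u x)"
      proof
        fix z
        have "inv' h z = y \<longleftrightarrow> z = h y"
          using permutes_inverses[OF hp] by metis
        moreover have "U (inv' h z) = U z"
          using Uh[of "inv' h z"] permutes_inverses(1)[OF hp] by simp
        ultimately show "(U(y := u x) \<circ> inv' h) z = (U(h y := u x)) z"
          by simp
      qed
      also have "\<dots> = u \<circ> transpose x (h y)"
        by (simp add: swap y')
      also have "\<dots> = T \<circ> inv' (transpose x (h y) \<circ> g)"
        using g by (simp add: o_inv_distrib permutes_bij u_def comp_assoc)
      finally have "act (h \<circ> (transpose x y \<circ> g)) w = act (transpose x (h y) \<circ> g) w"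
        by (intro act_fixed_cong[OF w] permutes_compose[OF _ hp] perm y')
      then show ?thesis
        by (simp only: act_comp[OF hp perm[OF y'(1)] w'])
    qed
    have summand: "act (transpose x y \<circ> g) w \<in> carrier M" if "y \<in> Y" for y
      using perm[of y] w' that by (simp add: Y_def)
    have "act h ?R = (\<Oplus>y\<in>Y. act h (act (transpose x y \<circ> g) w))"
      by (rule act_finsum) (use summand hp in \<open>auto simp: sym_group_carrier\<close>)
    also have "\<dots> = (\<Oplus>y\<in>Y. act (transpose x (h y) \<circ> g) w)"
      by (rule M.finsum_cong') (use summand hY step in \<open>auto simp del: o_apply\<close>)
    also have "\<dots> = (\<Oplus>y\<in>h ` Y. act (transpose x y \<circ> g) w)"
      by (rule M.finsum_reindex[symmetric]) (use inj img summand in auto)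
    finally show ?thesis
      by (simp add: img)
  qed
  moreover have "?R \<in> carrier M"
    by (rule M.finsum_closed) (use w' perm in \<open>auto simp: Y_def\<close>)
  ultimately show "(\<Oplus>y\<in>{y\<in>{1..n}. ((T \<circ> inv' g)(x := r)) y = r}. act (transpose x y \<circ> g) w)
      \<in> fixed ((T \<circ> inv' g)(x := r))"
    by (simp add: fixed_def Y_def U_def u_def)
qed

end

section \<open>Simple modules of the symmetric group have scalar endomorphisms\<close>

context symmetric_group_module
begin

text \<open>
  Straightening: the raising relations rewrite the symmetrization of any \<open>g w\<close> into a multiple of
  \<open>w\<close>. Let \<open>u = T \<circ> g\<^sup>-\<^sup>1\<close>. If \<open>u = T\<close>, then \<open>g w = w\<close>. Otherwise let \<open>r\<close> be the first row
  of \<open>T\<close> some point \<open>x\<close> of which lies in another row \<open>s\<close> of \<open>u\<close>. All earlier rows of \<open>T\<close> and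
  \<open>u\<close> agree, so \<open>r < s\<close> and the raising relation for \<open>x\<close> and \<open>r\<close> applies. Its terms with
  \<open>y\<close> in row \<open>r\<close> of \<open>T\<close> differ from \<open>g w\<close> by an element of the stabilizer, so they all have
  the same symmetrization; there are between \<open>1\<close> and \<open>n\<close> of them, a number invertible in \<open>k\<close>.
  In the other terms \<open>y\<close> lies in a row \<open>T y > r\<close>; there the exchange of \<open>x\<close> and \<open>y\<close> brings
  \<open>u\<close> closer to \<open>T\<close>: \<open>\<Sum>(T z - u z)\<^sup>2\<close> drops by \<open>2 (s - r) (T y - r)\<close>. This sum is the
  induction measure.
\<close>

lemma stab_sum_act_highest:
  assumes w: "w \<in> fixed T"
    and minimal: "\<And>U x. sum U {1..n} < sum T {1..n} \<Longrightarrow> x \<in> fixed U \<Longrightarrow> x = \<zero>"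
    and g: "g permutes {1..n}"
  shows "\<exists>c. stab_sum T \<odot> act g w = scale c w"
  using g
proof (induction "nat (\<Sum>z\<in>{1..n}. (int (T z) - int ((T \<circ> inv' g) z))\<^sup>2)" arbitrary: g rule: less_induct)
  case less
  note g = \<open>g permutes {1..n}\<close>
  define u where "u = T \<circ> inv' g"
  have w': "w \<in> carrier M"
    using w by (simp add: fixed_def)
  show ?case
  proof (cases "u = T")
    case True
    have "act g w = act id w"
      by (rule act_fixed_cong[OF w g permutes_id]) (use True in \<open>simp add: u_def\<close>)
    then show ?thesis
      using stab_sum_fixed[OF w] w' by (auto simp: act_id)
  next
    case False
    have outside: "u z = T z" if "z \<notin> {1..n}" for z
      using permutes_inv[OF g] that by (simp add: u_def permutes_not_in)
    let ?bad = "\<lambda>r. \<exists>x\<in>{1..n}. T x = r \<and> u x \<noteq> r"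
    obtain x0 where "u x0 \<noteq> T x0"
      using False by auto
    then have "?bad (T x0)"
      using outside by blast
    define r where "r = (LEAST r. ?bad r)"
    have r: "?bad r"
      unfolding r_def by (rule LeastI[of ?bad]) fact
    have least: "\<not> ?bad i" if "i < r" for i
      using that unfolding r_def by (rule not_less_Least)
    obtain x where x: "x \<in> {1..n}" "T x = r" "u x \<noteq> r"
      using r by blast
    \<comment> \<open>the rows \<open>i\<close> of \<open>T\<close> and of \<open>u\<close> have equal size, so for \<open>i < r\<close> inclusion gives equality\<close>
    have row_eq: "T z = i" if i: "i < r" and z: "z \<in> {1..n}" "u z = i" for i z
    proof -
      let ?A = "{z\<in>{1..n}. T z = i}" and ?B = "{z\<in>{1..n}. u z = i}"
      have "z \<in> ?B \<longleftrightarrow> z \<in> g ` ?A" for z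
      proof
        assume "z \<in> ?B"
        then have "inv' g z \<in> ?A"
          using permutes_in_image[OF permutes_inv[OF g], of z] by (simp add: u_def)
        then show "z \<in> g ` ?A"
          by (rule image_eqI[rotated]) (simp add: permutes_inverses(1)[OF g])
      next
        assume "z \<in> g ` ?A"
        then obtain a where "a \<in> ?A" "z = g a"
          by blast
        then show "z \<in> ?B"
          using permutes_in_image[OF g, of a] by (simp add: u_def permutes_inverses(2)[OF g])
      qed
      then have "?B = g ` ?A"
        by blast
      then have "card ?B = card ?A"
        using card_image[OF permutes_inj_on[OF g], of ?A] by simp
      moreover have "?A \<subseteq> ?B"
        using least[OF i] by blast
      ultimately have "?A = ?B"
        by (intro card_subset_eq) auto
      then show ?thesis
        using z by blast
    qed
    define s where "s = u x"
    have rs: "r < s"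
    proof (rule ccontr)
      assume "\<not> r < s"
      then have "u x < r"
        using x(3) by (simp add: s_def)
      then have "T x = u x"
        using x(1) by (rule row_eq) simp
      then show False
        using x by simp
    qed
    define Y where "Y = {y\<in>{1..n}. (u(x := r)) y = r}"
    \<comment> \<open>\<open>Y1\<close> indexes the terms with the symmetrization of \<open>g w\<close>, \<open>Y2\<close> those closer to \<open>T\<close>\<close>
    define Y1 where "Y1 = {y\<in>Y. T y = r}"
    define Y2 where "Y2 = {y\<in>Y. T y \<noteq> r}"
    have Y: "Y = Y1 \<union> Y2" "Y1 \<inter> Y2 = {}" "finite Y1" "finite Y2" "x \<in> Y1" "Y1 \<subseteq> {1..n}" "Y2 \<subseteq> {1..n}"
      using x by (auto simp: Y1_def Y2_def Y_def)
    have swap: "transpose x y permutes {1..n}" if "y \<in> Y" for y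
      using that x by (auto simp: Y_def intro: permutes_swap_id)
    have perm: "transpose x y \<circ> g permutes {1..n}" if "y \<in> Y" for y
      using permutes_compose[OF g swap[OF that]] .
    define z where "z = stab_sum T \<odot> act g w"
    have z: "z \<in> carrier M"
      using w' g by (simp add: z_def)
    have Y1: "stab_sum T \<odot> act (transpose x y \<circ> g) w = z" if y: "y \<in> Y1" for y
    proof -
      have y': "y \<in> Y" "T y = r"
        using y by (auto simp: Y1_def)
      have "T \<circ> transpose x y = T"
        by (rule ext) (simp add: transpose_def y' x(2))
      then have "transpose x y \<in> stab T"
        using swap[OF y'(1)] by (simp add: stab_def)
      then have "stab_sum T \<odot> act (transpose x y) (act g w) = z"
        using g w' by (simp add: stab_sum_act z_def)
      then show ?thesis
        by (simp add: act_comp[OF swap[OF y'(1)] g w'])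
    qed
    have "\<exists>c. stab_sum T \<odot> act (transpose x y \<circ> g) w = scale c w" if y: "y \<in> Y2" for y
    proof (rule less.hyps)
      have yx: "T y \<noteq> r" "y \<noteq> x"
        using y x(2) by (auto simp: Y2_def)
      then have y': "y \<in> Y" "y \<in> {1..n}" "T y \<noteq> r" "y \<noteq> x" "u y = r"
        using y by (auto simp: Y2_def Y_def)
      have Ty: "r < T y"
      proof (rule ccontr)
        assume "\<not> r < T y"
        then have "T y < r"
          using y'(3) by simp
        then have "\<not> ?bad (T y)"
          by (rule least)
        then show False
          using y' by auto
      qed
      let ?u = "u \<circ> transpose x y"
      have u: "T \<circ> inv' (transpose x y \<circ> g) = ?u"
        using g by (simp add: o_inv_distrib permutes_bij u_def comp_assoc)
      let ?d = "\<lambda>v z. (int (T z) - int (v z))\<^sup>2"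
      have split: "sum (?d v) {1..n} = ?d v x + ?d v y + sum (?d v) ({1..n} - {x} - {y})" for v
      proof -
        have "sum (?d v) {1..n} = ?d v x + sum (?d v) ({1..n} - {x})"
          by (rule sum.remove) (use x in auto)
        also have "sum (?d v) ({1..n} - {x}) = ?d v y + sum (?d v) ({1..n} - {x} - {y})"
          by (rule sum.remove) (use y' in auto)
        finally show ?thesis
          by simp
      qed
      have "sum (?d ?u) ({1..n} - {x} - {y}) = sum (?d u) ({1..n} - {x} - {y})"
        by (rule sum.cong) auto
      moreover have "?d ?u x + ?d ?u y < ?d u x + ?d u y"
      proof -
        have "?u x = r" "?u y = s"
          using y' by (simp_all add: s_def)
        moreover have "(int r - int s)\<^sup>2 + (int (T y) - int r)\<^sup>2 =
            (int (T y) - int s)\<^sup>2 + 2 * ((int s - int r) * (int (T y) - int r))"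
          by (simp add: power2_eq_square algebra_simps)
        moreover have "0 < (int s - int r) * (int (T y) - int r)"
          using rs Ty by simp
        ultimately show ?thesis
          using x(2) y'(5) s_def by simp
      qed
      ultimately have "sum (?d ?u) {1..n} < sum (?d u) {1..n}"
        by (simp only: split)
      moreover have "0 \<le> sum (?d ?u) {1..n}"
        by (simp add: sum_nonneg)
      ultimately show "nat (\<Sum>z\<in>{1..n}. (int (T z) - int ((T \<circ> inv' (transpose x y \<circ> g)) z))\<^sup>2)
          < nat (\<Sum>z\<in>{1..n}. (int (T z) - int ((T \<circ> inv' g) z))\<^sup>2)"
        by (simp only: u u_def[symmetric])
      show "transpose x y \<circ> g permutes {1..n}"
        using perm y' by blast
    qed
    then obtain d where d: "\<And>y. y \<in> Y2 \<Longrightarrow> stab_sum T \<odot> act (transpose x y \<circ> g) w = scale (d y) w"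
      by metis
    have closed: "act (transpose x y \<circ> g) w \<in> carrier M" if "y \<in> Y" for y
      using perm[OF that] w' by simp
    let ?k = "of_nat (card Y1) :: 'k"
    have "(\<Oplus>y\<in>Y. act (transpose x y \<circ> g) w) = \<zero>"
      unfolding Y_def u_def
    proof (rule raising_relation[OF w _ g x(1)])
      show "r < (T \<circ> inv' g) x"
        using rs by (simp add: s_def u_def)
    qed (rule minimal)
    then have "\<zero> = stab_sum T \<odot> (\<Oplus>y\<in>Y. act (transpose x y \<circ> g) w)"
      by (simp add: smult_zero)
    also have "\<dots> = (\<Oplus>y\<in>Y. stab_sum T \<odot> act (transpose x y \<circ> g) w)"
      by (rule smult_finsum) (use closed in auto)
    also have "\<dots> = (\<Oplus>y\<in>Y1. stab_sum T \<odot> act (transpose x y \<circ> g) w) \<oplus>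
        (\<Oplus>y\<in>Y2. stab_sum T \<odot> act (transpose x y \<circ> g) w)"
      unfolding Y(1) by (rule M.finsum_Un_disjoint) (use Y closed in auto)
    also have "(\<Oplus>y\<in>Y1. stab_sum T \<odot> act (transpose x y \<circ> g) w) = (\<Oplus>y\<in>Y1. scale 1 z)"
      by (rule M.finsum_cong') (use z Y1 in \<open>auto simp: scale_one\<close>)
    also have "\<dots> = scale ?k z"
      using z by (simp flip: scale_sum)
    also have "(\<Oplus>y\<in>Y2. stab_sum T \<odot> act (transpose x y \<circ> g) w) = (\<Oplus>y\<in>Y2. scale (d y) w)"
      by (rule M.finsum_cong') (use d w' in auto)
    also have "\<dots> = scale (sum d Y2) w"
      using w' by (simp add: scale_sum)
    finally have "scale ?k z \<oplus> scale (sum d Y2) w = \<zero>"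
      by simp
    then have "scale ?k z = \<ominus> scale (sum d Y2) w"
      using z w' by (metis M.minus_equality scale_closed)
    also have "\<dots> = scale (- sum d Y2) w"
      using w' by (simp add: scale_scale flip: scale_minus_one)
    finally have "scale ?k z = scale (- sum d Y2) w" .
    then have "scale (inverse ?k * ?k) z = scale (inverse ?k * (- sum d Y2)) w"
      using z w' by (metis scale_scale)
    moreover have "0 < card Y1"
      using Y card_gt_0_iff by blast
    moreover have "card Y1 \<le> n"
      using card_mono[OF _ Y(6)] by simp
    ultimately have "z = scale (inverse ?k * (- sum d Y2)) w"
      using z of_nat_neq_zero[of "card Y1"] by (simp add: scale_one)
    then show ?thesis
      unfolding z_def by blast
  qed
qed

text \<open>
  Nonzero fixed vectors exist for some \<open>T\<close>: an injective \<open>T\<close> has trivial stabilizer, and then every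
  vector is fixed. Among all such \<open>T\<close> one takes the least sum.
\<close>

lemma obtain_highest_vector:
  assumes "carrier M \<noteq> {\<zero>}"
  obtains T w where "w \<in> fixed T" "w \<noteq> \<zero>"
    "\<And>U x. sum U {1..n} < sum T {1..n} \<Longrightarrow> x \<in> fixed U \<Longrightarrow> x = \<zero>"
proof -
  let ?P = "\<lambda>T. \<exists>w\<in>fixed T. w \<noteq> \<zero>"
  obtain v where v: "v \<in> carrier M" "v \<noteq> \<zero>"
    using assms M.zero_closed by blast
  have "stab id = {id}"
    by (auto simp: stab_def permutes_id)
  then have "v \<in> fixed id"
    using v by (simp add: fixed_def act_id)
  then have "?P id"
    using v by blast
  then obtain T where "?P T" "\<forall>U. ?P U \<longrightarrow> sum T {1..n} \<le> sum U {1..n}"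
    using ex_has_least_nat[of ?P id "\<lambda>T. sum T {1..n}"] by blast
  then show ?thesis
    using that by (meson not_less)
qed

text \<open>
  Symmetrizing \<open>M = kG w\<close> shows that the fixed vectors of the stabilizer \<open>P\<close> form the line spanned
  by the highest vector \<open>w\<close>; here \<open>|P|\<close> is inverted. An endomorphism preserves \<open>M\<^sup>P\<close>, so it
  multiplies \<open>w\<close> by a scalar, and then all of \<open>kG w\<close>.
\<close>

theorem endomorphism_scalar:
  assumes simple: "simple_module KG M" and h: "h \<in> module_hom KG M M"
  shows "\<exists>c. \<forall>x\<in>carrier M. h x = scale c x"
proof -
  have "left_module_hom KG M M h"
    by (intro left_module_hom.intro left_module_hom_axioms.intro left_module_axioms h)
  note h_smult = left_module_hom.smult[OF this]
  have "carrier M \<noteq> {\<zero>}"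
    using simple by (simp add: simple_module_def)
  then obtain T w where w: "w \<in> fixed T" "w \<noteq> \<zero>"
    and minimal: "\<And>U x. sum U {1..n} < sum T {1..n} \<Longrightarrow> x \<in> fixed U \<Longrightarrow> x = \<zero>"
    using obtain_highest_vector by metis
  have w': "w \<in> carrier M"
    using w by (simp add: fixed_def)
  have multiple: "\<exists>c. x = scale c w" if x: "x \<in> fixed T" for x
  proof -
    have x': "x \<in> carrier M"
      using x by (simp add: fixed_def)
    obtain a where a: "a \<in> carrier KG" "x = a \<odot> w"
      using simple_module_cyclic[OF simple w' w(2) x'] by blast
    have "\<exists>c. stab_sum T \<odot> act g w = scale c w" if "g \<in> carrier (sym_group n)" for g
    proof (rule stab_sum_act_highest[OF w(1)])
      show "g permutes {1..n}"
        using that by (simp add: sym_group_carrier)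
    qed (rule minimal)
    then obtain d where d:
      "\<And>g. g \<in> carrier (sym_group n) \<Longrightarrow> stab_sum T \<odot> act g w = scale (d g) w"
      by metis
    let ?k = "of_nat (card (stab T)) :: 'k"
    have "scale ?k x = stab_sum T \<odot> (\<Oplus>g\<in>carrier (sym_group n). scale (a g) (act g w))"
      using stab_sum_fixed[OF x] a w' by (simp add: smult_eq_finsum)
    also have "\<dots> = (\<Oplus>g\<in>carrier (sym_group n). stab_sum T \<odot> scale (a g) (act g w))"
      by (rule smult_finsum) (use w' in auto)
    also have "\<dots> = (\<Oplus>g\<in>carrier (sym_group n). scale (a g * d g) w)"
      by (rule M.finsum_cong') (use w' d in \<open>auto simp: scale_scale simp flip: scale_smult\<close>)
    also have "\<dots> = scale (\<Sum>g\<in>carrier (sym_group n). a g * d g) w"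
      using w' by (simp add: scale_sum)
    finally have "scale (inverse ?k * ?k) x =
        scale (inverse ?k * (\<Sum>g\<in>carrier (sym_group n). a g * d g)) w"
      using x' w' by (metis scale_scale)
    then show ?thesis
      using card_stab_neq_zero x' by (auto simp: scale_one)
  qed
  have "h w \<in> fixed T"
    unfolding fixed_def
  proof (intro CollectI conjI ballI)
    show "h w \<in> carrier M"
      using h w' by (auto simp: LinearCombinations.module_hom_def)
    fix k assume k: "k \<in> stab T"
    then have "k \<in> carrier (sym_group n)"
      using stab_subset by blast
    then have "h (act k w) = act k (h w)"
      using w' by (simp add: act_def h_smult)
    then show "act k (h w) = h w"
      using w(1) k by (simp add: fixed_def)
  qed
  then obtain c where c: "h w = scale c w"
    using multiple by blast
  have "h x = scale c x" if x: "x \<in> carrier M" for x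
  proof -
    obtain a where a: "a \<in> carrier KG" "x = a \<odot> w"
      using simple_module_cyclic[OF simple w' w(2) x] by blast
    then show ?thesis
      using w' by (simp add: h_smult c scale_smult)
  qed
  then show ?thesis
    by blast
qed

end

section \<open>Finite direct sums of simple modules\<close>

locale finite_direct_sum = ring R for R :: "('a, 'c) ring_scheme" +
  fixes I :: "'i set" and N :: "'i \<Rightarrow> ('a, 'b, 'd) module_scheme"
  assumes finite_index: "finite I"
    and summand: "\<And>p. p \<in> I \<Longrightarrow> left_module R (N p)"
begin

abbreviation W :: "('a, 'i \<Rightarrow> 'b) module" where "W \<equiv> direct_sum_family I N"

sublocale W: left_module R W
  by (rule direct_sum_family_left_module[OF ring_axioms summand])

lemma carrier_W: "carrier W = (\<Pi>\<^sub>E p\<in>I. carrier (N p))"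
  by (simp add: direct_sum_family_def)

lemma component_closed: "x \<in> carrier W \<Longrightarrow> p \<in> I \<Longrightarrow> x p \<in> carrier (N p)"
  by (auto simp: carrier_W)

lemma W_eqI:
  assumes "x \<in> carrier W" "y \<in> carrier W" "\<And>p. p \<in> I \<Longrightarrow> x p = y p"
  shows "x = y"
  using assms unfolding carrier_W by (rule PiE_ext)

lemma component_hom:
  assumes "p \<in> I"
  shows "left_module_hom R W (N p) (\<lambda>x. x p)"
  by (intro left_module_hom.intro left_module_hom_axioms.intro W.left_module_axioms summand assms)
    (use assms in \<open>auto simp: LinearCombinations.module_hom_def direct_sum_family_def\<close>)

definition inj_summand :: "'i \<Rightarrow> 'b \<Rightarrow> 'i \<Rightarrow> 'b"
  where "inj_summand p s = (\<lambda>q\<in>I. if q = p then s else \<zero>\<^bsub>N q\<^esub>)"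

lemma inj_summand_hom:
  assumes p: "p \<in> I"
  shows "left_module_hom R (N p) W (inj_summand p)"
proof (intro left_module_hom.intro left_module_hom_axioms.intro W.left_module_axioms summand p)
  interpret Np: left_module R "N p"
    by (rule summand[OF p])
  have zero: "\<zero>\<^bsub>N q\<^esub> \<in> carrier (N q)" "\<zero>\<^bsub>N q\<^esub> \<oplus>\<^bsub>N q\<^esub> \<zero>\<^bsub>N q\<^esub> = \<zero>\<^bsub>N q\<^esub>"
    "a \<in> carrier R \<Longrightarrow> a \<odot>\<^bsub>N q\<^esub> \<zero>\<^bsub>N q\<^esub> = \<zero>\<^bsub>N q\<^esub>" if "q \<in> I" for q a
  proof -
    interpret Nq: left_module R "N q"
      by (rule summand[OF that])
    show "\<zero>\<^bsub>N q\<^esub> \<in> carrier (N q)" "\<zero>\<^bsub>N q\<^esub> \<oplus>\<^bsub>N q\<^esub> \<zero>\<^bsub>N q\<^esub> = \<zero>\<^bsub>N q\<^esub>"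
      by simp_all
    show "a \<in> carrier R \<Longrightarrow> a \<odot>\<^bsub>N q\<^esub> \<zero>\<^bsub>N q\<^esub> = \<zero>\<^bsub>N q\<^esub>"
      by (rule Nq.smult_zero)
  qed
  show "inj_summand p \<in> module_hom R (N p) W"
    unfolding LinearCombinations.module_hom_def
    using zero by (auto simp: inj_summand_def direct_sum_family_def fun_eq_iff)
qed

lemma inj_summand_apply:
  "q \<in> I \<Longrightarrow> inj_summand p s q = (if q = p then s else \<zero>\<^bsub>N q\<^esub>)"
  by (simp add: inj_summand_def)

lemma sum_of_components:
  assumes x: "x \<in> carrier W"
  shows "x = (\<Oplus>\<^bsub>W\<^esub>p\<in>I. inj_summand p (x p))"
proof (rule W_eqI[OF x])
  have closed: "inj_summand p (x p) \<in> carrier W" if "p \<in> I" for p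
    using left_module_hom.closed[OF inj_summand_hom[OF that]] component_closed[OF x that] by blast
  then show "(\<Oplus>\<^bsub>W\<^esub>p\<in>I. inj_summand p (x p)) \<in> carrier W"
    by (intro W.M.finsum_closed) auto
  fix q assume q: "q \<in> I"
  interpret Nq: left_module R "N q"
    by (rule summand[OF q])
  have "(\<Oplus>\<^bsub>W\<^esub>p\<in>I. inj_summand p (x p)) q = (\<Oplus>\<^bsub>N q\<^esub>p\<in>I. inj_summand p (x p) q)"
    by (rule left_module_hom.finsum[OF component_hom[OF q]]) (use closed in auto)
  also have "\<dots> = (\<Oplus>\<^bsub>N q\<^esub>p\<in>I. if q = p then x q else \<zero>\<^bsub>N q\<^esub>)"
    by (rule Nq.M.finsum_cong')
      (use q component_closed[OF x q] in \<open>auto simp: inj_summand_apply\<close>)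
  also have "\<dots> = x q"
    by (rule Nq.M.finsum_singleton)
      (use q finite_index component_closed[OF x q] in auto)
  finally show "x q = (\<Oplus>\<^bsub>W\<^esub>p\<in>I. inj_summand p (x p)) q" ..
qed

text \<open>
  Every proper submodule \<open>K\<close> of a finite direct sum of simple modules is killed by a retraction onto
  one of the summands. Enlarge \<open>K\<close> to a proper submodule \<open>L\<close> containing as many summands as
  possible, and take a summand not contained in \<open>L\<close>. It meets \<open>L\<close> in \<open>0\<close> by simplicity and spans the whole module together with \<open>L\<close> by
  maximality, so the projection along \<open>L\<close> is the required retraction.
\<close>

lemma simple_summand_complement:
  assumes simple: "\<And>p. p \<in> I \<Longrightarrow> simple_module R (N p)"
    and K: "Module.submodule K R W" "K \<noteq> carrier W"
  obtains p \<pi> where "p \<in> I" "left_module_hom R W (N p) \<pi>"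
    "\<And>x. x \<in> K \<Longrightarrow> \<pi> x = \<zero>\<^bsub>N p\<^esub>" "\<And>s. s \<in> carrier (N p) \<Longrightarrow> \<pi> (inj_summand p s) = s"
proof -
  let ?P = "\<lambda>L. Module.submodule L R W \<and> K \<subseteq> L \<and> L \<noteq> carrier W"
  let ?c = "\<lambda>L. card {p \<in> I. inj_summand p ` carrier (N p) \<subseteq> L}"
  have "\<forall>L. ?P L \<longrightarrow> ?c L < Suc (card I)"
    using finite_index by (auto simp: less_Suc_eq_le intro!: card_mono)
  moreover have "?P K"
    using K by simp
  ultimately obtain L where L: "?P L" and maximal: "\<forall>L'. ?P L' \<longrightarrow> ?c L' \<le> ?c L"
    using ex_has_greatest_nat[of ?P K ?c "Suc (card I)"] by blast
  have L': "L \<subseteq> carrier W" "\<zero>\<^bsub>W\<^esub> \<in> L"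
      "\<And>x y. x \<in> L \<Longrightarrow> y \<in> L \<Longrightarrow> x \<oplus>\<^bsub>W\<^esub> y \<in> L"
      "\<And>a x. a \<in> carrier R \<Longrightarrow> x \<in> L \<Longrightarrow> a \<odot>\<^bsub>W\<^esub> x \<in> L"
    using L by (auto simp: W.submodule_iff)
  have "\<exists>p\<in>I. \<not> inj_summand p ` carrier (N p) \<subseteq> L"
  proof (rule ccontr)
    assume "\<not> ?thesis"
    then have "inj_summand p (x p) \<in> L" if "p \<in> I" "x \<in> carrier W" for p x
      using component_closed[OF that(2,1)] that by blast
    then have "x \<in> L" if "x \<in> carrier W" for x
      using that L by (subst sum_of_components[OF that]) (auto intro!: W.finsum_mem_submodule)
    then show False
      using L L'(1) by blast
  qed
  then obtain p where p: "p \<in> I" "\<not> inj_summand p ` carrier (N p) \<subseteq> L"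
    by blast
  interpret Np: left_module R "N p"
    by (rule summand[OF p(1)])
  interpret inc: left_module_hom R "N p" W "inj_summand p"
    by (rule inj_summand_hom[OF p(1)])
  \<comment> \<open>\<open>rep x s\<close>: the summand component of \<open>x\<close> along \<open>L\<close> is \<open>s\<close>\<close>
  define rep where "rep x s \<longleftrightarrow> s \<in> carrier (N p) \<and> (\<exists>k\<in>L. x = k \<oplus>\<^bsub>W\<^esub> inj_summand p s)" for x s
  have rep_add: "rep (x \<oplus>\<^bsub>W\<^esub> y) (s \<oplus>\<^bsub>N p\<^esub> s')" if xy: "rep x s" "rep y s'" for x y s s'
  proof -
    obtain k k' where k: "k \<in> L" "k' \<in> L" "x = k \<oplus>\<^bsub>W\<^esub> inj_summand p s" "y = k' \<oplus>\<^bsub>W\<^esub> inj_summand p s'"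
      and s: "s \<in> carrier (N p)" "s' \<in> carrier (N p)"
      using xy by (auto simp: rep_def)
    then have "x \<oplus>\<^bsub>W\<^esub> y = (k \<oplus>\<^bsub>W\<^esub> k') \<oplus>\<^bsub>W\<^esub> inj_summand p (s \<oplus>\<^bsub>N p\<^esub> s')"
      using subsetD[OF L'(1)] by (simp add: inc.add W.M.a_ac)
    then show ?thesis
      using k s L'(3) by (auto simp: rep_def)
  qed
  have rep_smult: "rep (a \<odot>\<^bsub>W\<^esub> x) (a \<odot>\<^bsub>N p\<^esub> s)" if x: "rep x s" and a: "a \<in> carrier R" for a x s
  proof -
    obtain k where k: "k \<in> L" "x = k \<oplus>\<^bsub>W\<^esub> inj_summand p s" and s: "s \<in> carrier (N p)"
      using x by (auto simp: rep_def)
    then have "a \<odot>\<^bsub>W\<^esub> x = a \<odot>\<^bsub>W\<^esub> k \<oplus>\<^bsub>W\<^esub> inj_summand p (a \<odot>\<^bsub>N p\<^esub> s)"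
      using subsetD[OF L'(1)] a by (simp add: inc.smult W.smult_r_distr)
    then show ?thesis
      using k s a L'(4) by (auto simp: rep_def)
  qed
  have rep_L: "rep x \<zero>\<^bsub>N p\<^esub>" if "x \<in> L" for x
    using that L'(1) by (auto simp: rep_def inc.zero intro!: bexI[of _ x])
  have rep_inc: "rep (inj_summand p s) s" if "s \<in> carrier (N p)" for s
    using that L'(2) by (auto simp: rep_def intro!: bexI[of _ "\<zero>\<^bsub>W\<^esub>"])
  have ex: "\<exists>s. rep x s" if x: "x \<in> carrier W" for x
  proof -
    let ?L = "{x. \<exists>s. rep x s}"
    have "?L \<subseteq> carrier W"
      using L'(1) by (auto simp: rep_def)
    then have sub: "Module.submodule ?L R W"
      using rep_add rep_smult rep_L[OF L'(2)] unfolding W.submodule_iff by blast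
    \<comment> \<open>the sum of \<open>L\<close> and the summand contains at least one more summand than \<open>L\<close>\<close>
    have "{q \<in> I. inj_summand q ` carrier (N q) \<subseteq> L} \<subset> {q \<in> I. inj_summand q ` carrier (N q) \<subseteq> ?L}"
      using p rep_L rep_inc by (intro psubsetI) blast+
    then have "?c L < ?c ?L"
      using finite_index by (intro psubset_card_mono) auto
    then have "\<not> ?P ?L"
      using maximal by (meson not_less)
    moreover have "K \<subseteq> ?L"
      using L rep_L by blast
    ultimately show ?thesis
      using sub x by blast
  qed
  have inc_L: "s = \<zero>\<^bsub>N p\<^esub>" if s: "s \<in> carrier (N p)" "inj_summand p s \<in> L" for s
  proof -
    have "Module.submodule {s \<in> carrier (N p). inj_summand p s \<in> L} R (N p)"
      using L by (intro inc.vimage_submodule) simp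
    then have "{s \<in> carrier (N p). inj_summand p s \<in> L} = {\<zero>\<^bsub>N p\<^esub>}"
      using simple[OF p(1)] p(2) unfolding simple_module_def by blast
    then show ?thesis
      using s by blast
  qed
  have zero_rep: "s = \<zero>\<^bsub>N p\<^esub>" if zero: "rep \<zero>\<^bsub>W\<^esub> s" for s
  proof -
    obtain k where k: "k \<in> L" "\<zero>\<^bsub>W\<^esub> = k \<oplus>\<^bsub>W\<^esub> inj_summand p s" and s: "s \<in> carrier (N p)"
      using zero by (auto simp: rep_def)
    have "inj_summand p s = \<ominus>\<^bsub>W\<^esub> k"
    proof (rule W.M.minus_equality[symmetric])
      show "inj_summand p s \<oplus>\<^bsub>W\<^esub> k = \<zero>\<^bsub>W\<^esub>"
        using k s subsetD[OF L'(1)] by (simp add: W.M.a_comm)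
    qed (use k s L'(1) in auto)
    also have "\<dots> = (\<ominus>\<^bsub>R\<^esub> \<one>\<^bsub>R\<^esub>) \<odot>\<^bsub>W\<^esub> k"
      using k L'(1) by (intro W.minus_one_smult[symmetric]) auto
    finally have "inj_summand p s \<in> L"
      using L'(4)[OF _ k(1)] by simp
    then show ?thesis
      using s inc_L by blast
  qed
  have unique: "s = s'" if x: "rep x s" "rep x s'" for x s s'
  proof -
    have s: "s \<in> carrier (N p)" "s' \<in> carrier (N p)" and xW: "x \<in> carrier W"
      using x L'(1) by (auto simp: rep_def)
    have "rep (x \<oplus>\<^bsub>W\<^esub> (\<ominus>\<^bsub>R\<^esub> \<one>\<^bsub>R\<^esub>) \<odot>\<^bsub>W\<^esub> x) (s \<oplus>\<^bsub>N p\<^esub> (\<ominus>\<^bsub>R\<^esub> \<one>\<^bsub>R\<^esub>) \<odot>\<^bsub>N p\<^esub> s')"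
      using x by (intro rep_add rep_smult) auto
    then have "s \<oplus>\<^bsub>N p\<^esub> \<ominus>\<^bsub>N p\<^esub> s' = \<zero>\<^bsub>N p\<^esub>"
      using s xW zero_rep by (simp add: W.minus_one_smult Np.minus_one_smult W.M.r_neg)
    then show ?thesis
      using s by (simp flip: Np.M.minus_eq)
  qed
  define \<pi> where "\<pi> x = (SOME s. rep x s)" for x
  have \<pi>_eq: "\<pi> x = s" if "rep x s" for x s
    using that unique unfolding \<pi>_def by (metis someI)
  have rep_\<pi>: "rep x (\<pi> x)" if "x \<in> carrier W" for x
    using ex[OF that] unfolding \<pi>_def by (rule someI_ex)
  have "left_module_hom R W (N p) \<pi>"
  proof (intro left_module_hom.intro left_module_hom_axioms.intro
      W.left_module_axioms Np.left_module_axioms)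
    show "\<pi> \<in> module_hom R W (N p)"
      unfolding LinearCombinations.module_hom_def
      using rep_\<pi> rep_add rep_smult by (auto intro!: \<pi>_eq) (auto simp: rep_def)
  qed
  then show ?thesis
    using p(1) \<pi>_eq rep_L rep_inc L by (intro that[of p \<pi>]) blast+
qed

end

section \<open>Generators of isotypic sums\<close>

text \<open>
  Coefficientwise form of a linear combination of vectors given by their coordinates; it translates
  linear relations in \<open>S\<^sub>i\<^sup>r\<close> into systems of linear equations over \<open>k\<close>.
\<close>

lemma (in group_algebra_module) combination_of_combinations:
  assumes "finite J" "B \<subseteq> carrier M"
  shows "(\<Oplus>j\<in>J. scale (c j) (\<Oplus>b\<in>B. scale (a j b) b)) =
    (\<Oplus>b\<in>B. scale (\<Sum>j\<in>J. a j b * c j) b)"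
  using assms(1)
proof (induction J rule: finite_induct)
  case empty
  have "(\<Oplus>b\<in>B. scale 0 b) = (\<Oplus>b\<in>B. \<zero>)"
    by (rule M.finsum_cong') (use assms(2) in auto)
  then show ?case
    by simp
next
  case (insert j J)
  have B: "b \<in> carrier M" if "b \<in> B" for b
    using that assms(2) by blast
  have closed: "(\<Oplus>b\<in>B. scale (a j b) b) \<in> carrier M" for j
    using B by (intro M.finsum_closed) auto
  have "(\<Oplus>i\<in>insert j J. scale (c i) (\<Oplus>b\<in>B. scale (a i b) b)) =
      scale (c j) (\<Oplus>b\<in>B. scale (a j b) b) \<oplus> (\<Oplus>b\<in>B. scale (\<Sum>j\<in>J. a j b * c j) b)"
    using insert closed by simp
  also have "scale (c j) (\<Oplus>b\<in>B. scale (a j b) b) = (\<Oplus>b\<in>B. scale (a j b * c j) b)"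
    using B by (subst scale_finsum) (auto simp: scale_scale mult.commute intro!: M.finsum_cong')
  also have "(\<Oplus>b\<in>B. scale (a j b * c j) b) \<oplus> (\<Oplus>b\<in>B. scale (\<Sum>j\<in>J. a j b * c j) b) =
      (\<Oplus>b\<in>B. scale (a j b * c j) b \<oplus> scale (\<Sum>j\<in>J. a j b * c j) b)"
    by (rule M.finsum_addf[symmetric]) (use B in auto)
  also have "\<dots> = (\<Oplus>b\<in>B. scale (\<Sum>j\<in>insert j J. a j b * c j) b)"
    by (rule M.finsum_cong') (use B insert in \<open>auto simp: scale_add_left\<close>)
  finally show ?case .
qed

text \<open>Induction on the number of equations, by Gaussian elimination.\<close>

lemma homogeneous_system_nontrivial_solution:
  fixes a :: "'e \<Rightarrow> 'i \<Rightarrow> 'k :: field"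
  assumes "finite E" "finite I" "card E < card I"
  shows "\<exists>c. (\<exists>i\<in>I. c i \<noteq> 0) \<and> (\<forall>e\<in>E. (\<Sum>i\<in>I. a e i * c i) = 0)"
  using assms
proof (induction E arbitrary: I a rule: finite_induct)
  case empty
  then show ?case
    by (intro exI[of _ "\<lambda>_. 1"]) (auto simp: card_gt_0_iff)
next
  case (insert e E)
  show ?case
  proof (cases "\<forall>i\<in>I. a e i = 0")
    case True
    obtain c where "\<exists>i\<in>I. c i \<noteq> 0" "\<forall>f\<in>E. (\<Sum>i\<in>I. a f i * c i) = 0"
      using insert.IH[of I a] insert.prems insert.hyps by auto
    then show ?thesis
      using True by (intro exI[of _ c]) simp
  next
    case False
    then obtain p where p: "p \<in> I" "a e p \<noteq> 0"
      by blast
    let ?J = "I - {p}"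
    \<comment> \<open>solve equation \<open>e\<close> for the unknown \<open>p\<close> and substitute into the others\<close>
    let ?b = "\<lambda>f i. a f i - a f p * a e i / a e p"
    have "card E < card ?J"
      using insert p by simp
    then obtain c where c: "\<exists>i\<in>?J. c i \<noteq> 0" "\<forall>f\<in>E. (\<Sum>i\<in>?J. ?b f i * c i) = 0"
      using insert.IH[of ?J ?b] insert.prems by auto
    define s where "s = (\<Sum>i\<in>?J. a e i * c i)"
    let ?c = "c(p := - s / a e p)"
    have split: "(\<Sum>i\<in>I. a f i * ?c i) = a f p * (- s / a e p) + (\<Sum>i\<in>?J. a f i * c i)" for f
      using p insert.prems by (subst sum.remove[of I p]) (auto intro!: sum.cong)
    have "(\<Sum>i\<in>I. a f i * ?c i) = 0" if "f \<in> insert e E" for f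
    proof (cases "f = e")
      case True
      then show ?thesis
        using p by (simp only: split) (simp add: s_def)
    next
      case False
      then have "0 = (\<Sum>i\<in>?J. a f i * c i - a f p / a e p * (a e i * c i))"
        using c(2) that by (auto simp: algebra_simps diff_divide_distrib)
      also have "\<dots> = (\<Sum>i\<in>?J. a f i * c i) - a f p / a e p * s"
        by (simp add: sum_subtractf sum_distrib_left s_def)
      finally show ?thesis
        by (simp only: split) simp
    qed
    moreover have "\<exists>i\<in>I. ?c i \<noteq> 0"
      using c(1) by auto
    ultimately show ?thesis
      by blast
  qed
qed

locale isotypic_decomposition = G: group G for G :: "('g, 'c) monoid_scheme" +
  fixes t :: nat and m :: "nat \<Rightarrow> nat" and S :: "nat \<Rightarrow> ('g \<Rightarrow> 'k :: field, 'b, 'd) module_scheme"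
  assumes finite_group: "finite (carrier G)"
    and simple: "\<And>i. i \<in> {1..t} \<Longrightarrow> simple_module (group_algebra G) (S i)"
begin

abbreviation KG :: "('g \<Rightarrow> 'k) ring" where "KG \<equiv> group_algebra G"

sublocale finite_direct_sum KG "SIGMA i:{1..t}. {1..m i}" "\<lambda>(i, j). S i"
proof (intro finite_direct_sum.intro finite_direct_sum_axioms.intro)
  show "ring KG"
    by (rule group_algebra_ring[OF G.group_axioms finite_group])
qed (use simple in \<open>auto simp: simple_module_def\<close>)

lemma isotypic_sum_eq: "isotypic_sum t m S = W"
  by (simp add: isotypic_sum_def)

lemma simple_group_module:
  assumes "i \<in> {1..t}"
  shows "group_algebra_module G (S i)"
  by (intro group_algebra_module.intro group_algebra_module_axioms.intro G.group_axioms finite_group)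
    (use simple[OF assms] in \<open>simp add: simple_module_def\<close>)

text \<open>
  The \<open>m\<^sub>i\<close> vectors \<open>(f\<^sub>1(i, j), \<dots>, f\<^sub>r(i, j))\<close> lie in \<open>S\<^sub>i\<^sup>r\<close>, of dimension
  \<open>r dim S\<^sub>i\<close>. If there are more of them than that, some relation \<open>\<Sum>\<^sub>j c\<^sub>j f\<^sub>q(i, j) = 0\<close> holds for
  all \<open>q\<close>, and then the generators lie in the kernel of the nonzero homomorphism
  \<open>x \<mapsto> \<Sum>\<^sub>j c\<^sub>j x(i, j)\<close> to \<open>S\<^sub>i\<close>.
\<close>

lemma generated_imp_multiplicity_le:
  assumes gen: "r_generated KG r W" and i: "i \<in> {1..t}"
  shows "m i \<le> r * module_dim G (S i)"
proof (rule ccontr)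
  assume large: "\<not> m i \<le> r * module_dim G (S i)"
  interpret Si: group_algebra_module G "S i"
    by (rule simple_group_module[OF i])
  obtain f where "\<forall>q \<in> {1..r}. f q \<in> carrier W"
      and gen_f: "generated_submodule KG W (f ` {1..r}) = carrier W"
    using gen unfolding r_generated_def by blast
  then have f: "f q \<in> carrier W" if "q \<in> {1..r}" for q
    using that by blast
  obtain B where B: "finite B" "B \<subseteq> carrier (S i)" "card B = module_dim G (S i)"
    and spans: "\<And>x. x \<in> carrier (S i) \<Longrightarrow> \<exists>c. x = (\<Oplus>\<^bsub>S i\<^esub>b\<in>B. Si.scale (c b) b)"
    by (rule Si.simple_module_basis[OF simple[OF i]]) blast
  define coord where "coord x = (SOME c. x = (\<Oplus>\<^bsub>S i\<^esub>b\<in>B. Si.scale (c b) b))" for x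
  have coord: "(\<Oplus>\<^bsub>S i\<^esub>b\<in>B. Si.scale (coord x b) b) = x" if "x \<in> carrier (S i)" for x
    using someI_ex[OF spans[OF that]] unfolding coord_def by simp
  have component: "x (i, j) \<in> carrier (S i)" if "x \<in> carrier W" "j \<in> {1..m i}" for x j
    using component_closed[OF that(1), of "(i, j)"] that(2) i by simp
  define a where "a e j = coord (f (fst e) (i, j)) (snd e)" for e j
  have "\<exists>c. (\<exists>j\<in>{1..m i}. c j \<noteq> 0) \<and> (\<forall>e\<in>{1..r} \<times> B. (\<Sum>j\<in>{1..m i}. a e j * c j) = 0)"
    by (rule homogeneous_system_nontrivial_solution)
      (use B large in \<open>auto simp: card_cartesian_product\<close>)
  then obtain c j0 where j0: "j0 \<in> {1..m i}" "c j0 \<noteq> 0"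
    and c: "\<And>e. e \<in> {1..r} \<times> B \<Longrightarrow> (\<Sum>j\<in>{1..m i}. a e j * c j) = 0"
    by blast
  define \<phi> where "\<phi> x = (\<Oplus>\<^bsub>S i\<^esub>j\<in>{1..m i}. Si.scale (c j) (x (i, j)))" for x
  have closed: "Si.scale (c j) (x (i, j)) \<in> carrier (S i)" if "x \<in> carrier W" "j \<in> {1..m i}" for x j
    using component[OF that] by simp
  have "left_module_hom KG W (S i) \<phi>"
  proof (intro left_module_hom.intro left_module_hom_axioms.intro
      W.left_module_axioms Si.left_module_axioms)
    have "\<phi> x \<in> carrier (S i)" if "x \<in> carrier W" for x
      unfolding \<phi>_def by (rule Si.M.finsum_closed) (use closed[OF that] in auto)
    moreover have "\<phi> (x \<oplus>\<^bsub>W\<^esub> y) = \<phi> x \<oplus>\<^bsub>S i\<^esub> \<phi> y" if xy: "x \<in> carrier W" "y \<in> carrier W" for x y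
    proof -
      have "\<phi> (x \<oplus>\<^bsub>W\<^esub> y) = (\<Oplus>\<^bsub>S i\<^esub>j\<in>{1..m i}.
          Si.scale (c j) (x (i, j)) \<oplus>\<^bsub>S i\<^esub> Si.scale (c j) (y (i, j)))"
        unfolding \<phi>_def
      proof (rule Si.M.finsum_cong'[OF refl])
        fix j assume j: "j \<in> {1..m i}"
        have "(x \<oplus>\<^bsub>W\<^esub> y) (i, j) = x (i, j) \<oplus>\<^bsub>S i\<^esub> y (i, j)"
          using i j by (simp add: direct_sum_family_def)
        then show "Si.scale (c j) ((x \<oplus>\<^bsub>W\<^esub> y) (i, j)) =
            Si.scale (c j) (x (i, j)) \<oplus>\<^bsub>S i\<^esub> Si.scale (c j) (y (i, j))"
          using component[OF xy(1) j] component[OF xy(2) j] by (simp add: Si.scale_add)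
      qed (use closed xy in auto)
      also have "\<dots> = \<phi> x \<oplus>\<^bsub>S i\<^esub> \<phi> y"
        unfolding \<phi>_def by (rule Si.M.finsum_addf) (use closed xy in auto)
      finally show ?thesis .
    qed
    moreover have "\<phi> (b \<odot>\<^bsub>W\<^esub> x) = b \<odot>\<^bsub>S i\<^esub> \<phi> x" if b: "b \<in> carrier KG" and x: "x \<in> carrier W" for b x
    proof -
      have "\<phi> (b \<odot>\<^bsub>W\<^esub> x) = (\<Oplus>\<^bsub>S i\<^esub>j\<in>{1..m i}. b \<odot>\<^bsub>S i\<^esub> Si.scale (c j) (x (i, j)))"
        unfolding \<phi>_def
      proof (rule Si.M.finsum_cong'[OF refl])
        fix j assume j: "j \<in> {1..m i}"
        have "(b \<odot>\<^bsub>W\<^esub> x) (i, j) = b \<odot>\<^bsub>S i\<^esub> x (i, j)"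
          using i j by (simp add: direct_sum_family_def)
        then show "Si.scale (c j) ((b \<odot>\<^bsub>W\<^esub> x) (i, j)) = b \<odot>\<^bsub>S i\<^esub> Si.scale (c j) (x (i, j))"
          using b component[OF x j] by (simp add: Si.scale_smult)
      qed (use closed x b in auto)
      also have "\<dots> = b \<odot>\<^bsub>S i\<^esub> \<phi> x"
        unfolding \<phi>_def by (rule Si.smult_finsum[symmetric]) (use closed x b in auto)
      finally show ?thesis .
    qed
    ultimately show "\<phi> \<in> module_hom KG W (S i)"
      by (auto simp: LinearCombinations.module_hom_def)
  qed
  then interpret \<phi>: left_module_hom KG W "S i" \<phi> .
  have "\<phi> (f q) = \<zero>\<^bsub>S i\<^esub>" if q: "q \<in> {1..r}" for q
  proof -
    have "\<phi> (f q) = (\<Oplus>\<^bsub>S i\<^esub>j\<in>{1..m i}. Si.scale (c j) (\<Oplus>\<^bsub>S i\<^esub>b\<in>B. Si.scale (a (q, b) j) b))"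
      unfolding \<phi>_def
      by (rule Si.M.finsum_cong') (use coord component[OF f[OF q]] in \<open>auto simp: a_def\<close>)
    also have "\<dots> = (\<Oplus>\<^bsub>S i\<^esub>b\<in>B. Si.scale (\<Sum>j\<in>{1..m i}. a (q, b) j * c j) b)"
      using B by (intro Si.combination_of_combinations) auto
    also have "\<dots> = (\<Oplus>\<^bsub>S i\<^esub>b\<in>B. \<zero>\<^bsub>S i\<^esub>)"
      by (rule Si.M.finsum_cong') (use B c q in \<open>auto simp: subset_iff\<close>)
    finally show ?thesis
      by simp
  qed
  then have "f ` {1..r} \<subseteq> {x \<in> carrier W. \<phi> x = \<zero>\<^bsub>S i\<^esub>}"
    using f by auto
  then have ker: "{x \<in> carrier W. \<phi> x = \<zero>\<^bsub>S i\<^esub>} = carrier W"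
    using \<phi>.kernel_submodule W.generated_submodule_eq_carrier_iff[of "f ` {1..r}"] f gen_f by blast
  obtain v where v: "v \<in> carrier (S i)" "v \<noteq> \<zero>\<^bsub>S i\<^esub>"
    using simple[OF i] Si.M.zero_closed unfolding simple_module_def by blast
  let ?x = "inj_summand (i, j0) v"
  have x: "?x \<in> carrier W"
    using left_module_hom.closed[OF inj_summand_hom[of "(i, j0)"]] i j0 v by simp
  have component_x: "?x (i, j) = (if j0 = j then v else \<zero>\<^bsub>S i\<^esub>)" if "j \<in> {1..m i}" for j
    using inj_summand_apply[of "(i, j)" "(i, j0)" v] i that by auto
  have "\<phi> ?x = (\<Oplus>\<^bsub>S i\<^esub>j\<in>{1..m i}. if j0 = j then Si.scale (c j) v else \<zero>\<^bsub>S i\<^esub>)"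
    unfolding \<phi>_def
    by (rule Si.M.finsum_cong') (use v component_x in auto)
  also have "\<dots> = Si.scale (c j0) v"
    by (rule Si.M.finsum_singleton) (use j0 v in auto)
  finally have "\<phi> ?x = Si.scale (c j0) v" .
  moreover have "\<phi> ?x = \<zero>\<^bsub>S i\<^esub>"
    using x ker by blast
  ultimately have "Si.scale (c j0) v = \<zero>\<^bsub>S i\<^esub>"
    by simp
  then show False
    using v j0 by (simp add: Si.scale_eq_zero_iff)
qed

text \<open>
  If \<open>m\<^sub>i \<le> r dim S\<^sub>i\<close>, the \<open>m\<^sub>i\<close> vectors \<open>(f\<^sub>1(i, j), \<dots>, f\<^sub>r(i, j))\<close> can be chosen to be
  distinct members of the standard basis of \<open>S\<^sub>i\<^sup>r\<close>, whose elements are labelled by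
  \<open>{1..r} \<times> B\<^sub>i\<close>. Were the submodule generated by the \<open>f\<^sub>q\<close> proper, a retraction \<open>\<pi>\<close> onto some
  copy of some \<open>S\<^sub>i\<close> would kill all \<open>f\<^sub>q\<close>. By Schur's lemma \<open>\<pi>\<close> vanishes on the copies of the
  other \<open>S\<^sub>l\<close>, and it is a scalar \<open>c\<^sub>j\<close> on the \<open>j\<close>-th copy of \<open>S\<^sub>i\<close>. So
  \<open>\<Sum>\<^sub>j c\<^sub>j f\<^sub>q(i, j) = 0\<close> for all \<open>q\<close>, and linear independence gives \<open>c = 0\<close>, whereas \<open>\<pi>\<close> is the
  identity on one of the copies.
\<close>

lemma multiplicity_le_imp_generated:
  assumes endo: "\<And>i h. i \<in> {1..t} \<Longrightarrow> h \<in> module_hom KG (S i) (S i) \<Longrightarrow>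
      \<exists>c. \<forall>x\<in>carrier (S i). h x = group_algebra_module.scale G (S i) c x"
    and inequivalent: "\<And>i j. i \<in> {1..t} \<Longrightarrow> j \<in> {1..t} \<Longrightarrow>
      module_isomorphic KG (S i) (S j) \<Longrightarrow> i = j"
    and le: "\<And>i. i \<in> {1..t} \<Longrightarrow> m i \<le> r * module_dim G (S i)"
  shows "r_generated KG r W"
proof -
  define labelled where "labelled i B \<iota> \<longleftrightarrow> finite B \<and> B \<subseteq> carrier (S i) \<and>
      (\<forall>c. (\<Oplus>\<^bsub>S i\<^esub>b\<in>B. group_algebra_module.scale G (S i) (c b) b) = \<zero>\<^bsub>S i\<^esub> \<longrightarrow> (\<forall>b\<in>B. c b = 0)) \<and>
      inj_on \<iota> {1..m i} \<and> \<iota> ` {1..m i} \<subseteq> {1..r} \<times> B" for i B and \<iota> :: "nat \<Rightarrow> nat \<times> 'b"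
  have "\<exists>L. labelled i (fst L) (snd L)" if i: "i \<in> {1..t}" for i
  proof -
    interpret Si: group_algebra_module G "S i"
      by (rule simple_group_module[OF i])
    obtain B where B: "finite B" "B \<subseteq> carrier (S i)" "card B = module_dim G (S i)"
      and indep: "\<And>c b. (\<Oplus>\<^bsub>S i\<^esub>b\<in>B. Si.scale (c b) b) = \<zero>\<^bsub>S i\<^esub> \<Longrightarrow> b \<in> B \<Longrightarrow> c b = 0"
      by (rule Si.simple_module_basis[OF simple[OF i]]) blast
    have "card {1..m i} \<le> card ({1..r} \<times> B)"
      using le[OF i] B by (simp add: card_cartesian_product)
    then obtain \<iota> where \<iota>: "\<iota> ` {1..m i} \<subseteq> {1..r} \<times> B" "inj_on \<iota> {1..m i}"
      using card_le_inj[of "{1..m i}" "{1..r} \<times> B"] B by blast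
    have "labelled i B \<iota>"
      unfolding labelled_def using B \<iota> indep by blast
    then show ?thesis
      by (intro exI[of _ "(B, \<iota>)"]) simp
  qed
  then have "\<forall>i\<in>{1..t}. \<exists>L. labelled i (fst L) (snd L)"
    by blast
  then obtain L where L: "\<forall>i\<in>{1..t}. labelled i (fst (L i)) (snd (L i))"
    by (rule bchoice[THEN exE])
  define B where "B i = fst (L i)" for i
  define \<iota> where "\<iota> i = snd (L i)" for i
  have labelled: "labelled i (B i) (\<iota> i)" if "i \<in> {1..t}" for i
    using L that by (simp add: B_def \<iota>_def)
  have B: "B i \<subseteq> carrier (S i)" and inj: "inj_on (\<iota> i) {1..m i}"
    and img: "\<iota> i ` {1..m i} \<subseteq> {1..r} \<times> B i" if "i \<in> {1..t}" for i
    using labelled[OF that] unfolding labelled_def by blast+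
  have indep: "c b = 0" if "i \<in> {1..t}" "b \<in> B i"
    "(\<Oplus>\<^bsub>S i\<^esub>b\<in>B i. group_algebra_module.scale G (S i) (c b) b) = \<zero>\<^bsub>S i\<^esub>" for i c b
    using labelled[OF that(1)] that(2,3) unfolding labelled_def by blast
  \<comment> \<open>the vector \<open>(f q (i, j))\<^sub>q\<close> of \<open>S\<^sub>i\<^sup>r\<close> is the basis vector with label \<open>\<iota> i j\<close>\<close>
  define a :: "nat \<Rightarrow> nat \<Rightarrow> nat \<Rightarrow> 'b \<Rightarrow> 'k"
    where "a q i j b = (if \<iota> i j = (q, b) then 1 else 0)" for q i j b
  define f where "f q = (\<lambda>(i, j)\<in>(SIGMA i:{1..t}. {1..m i}).
      \<Oplus>\<^bsub>S i\<^esub>b\<in>B i. group_algebra_module.scale G (S i) (a q i j b) b)" for q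
  have f_apply: "f q (i, j) = (\<Oplus>\<^bsub>S i\<^esub>b\<in>B i. group_algebra_module.scale G (S i) (a q i j b) b)"
    if "i \<in> {1..t}" "j \<in> {1..m i}" for q i j
    using that by (simp add: f_def)
  have f_closed: "f q \<in> carrier W" for q
  proof -
    have "f q (i, j) \<in> carrier (S i)" if ij: "i \<in> {1..t}" "j \<in> {1..m i}" for i j
    proof -
      interpret Si: group_algebra_module G "S i"
        by (rule simple_group_module[OF ij(1)])
      show ?thesis
        unfolding f_apply[OF ij] by (rule Si.M.finsum_closed) (use B[OF ij(1)] in auto)
    qed
    then show ?thesis
      unfolding carrier_W by (auto simp: PiE_iff) (simp add: f_def)
  qed
  have "K = carrier W" if K: "Module.submodule K KG W" "f ` {1..r} \<subseteq> K" for K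
  proof (rule ccontr)
    assume proper: "K \<noteq> carrier W"
    have "\<And>p. p \<in> (SIGMA i:{1..t}. {1..m i}) \<Longrightarrow> simple_module KG ((\<lambda>(i, j). S i) p)"
      using simple by auto
    then obtain p \<pi> where p: "p \<in> (SIGMA i:{1..t}. {1..m i})"
      and \<pi>: "left_module_hom KG W ((\<lambda>(i, j). S i) p) \<pi>"
      and \<pi>_K: "\<And>x. x \<in> K \<Longrightarrow> \<pi> x = \<zero>\<^bsub>(\<lambda>(i, j). S i) p\<^esub>"
      and \<pi>_inc: "\<And>s. s \<in> carrier ((\<lambda>(i, j). S i) p) \<Longrightarrow> \<pi> (inj_summand p s) = s"
      using K(1) proper by (rule simple_summand_complement) blast+
    obtain i j0 where ij0: "p = (i, j0)" "i \<in> {1..t}" "j0 \<in> {1..m i}"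
      using p by blast
    interpret Si: group_algebra_module G "S i"
      by (rule simple_group_module[OF ij0(2)])
    interpret \<pi>: left_module_hom KG W "S i" \<pi>
      using \<pi> by (simp add: ij0)
    have comp: "left_module_hom KG (S i') (S i) (\<lambda>s. \<pi> (inj_summand (i', j) s))"
      if ij: "i' \<in> {1..t}" "j \<in> {1..m i'}" for i' j
    proof -
      have inc: "left_module_hom KG (S i') W (inj_summand (i', j))"
        using inj_summand_hom[of "(i', j)"] ij by simp
      interpret inc: left_module_hom KG "S i'" W "inj_summand (i', j)"
        by (rule inc)
      show ?thesis
      proof (intro left_module_hom.intro left_module_hom_axioms.intro
          inc.M.left_module_axioms Si.left_module_axioms)
        show "(\<lambda>s. \<pi> (inj_summand (i', j) s)) \<in> module_hom KG (S i') (S i)"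
          unfolding LinearCombinations.module_hom_def
          using inc.add inc.smult inc.closed \<pi>.add \<pi>.smult \<pi>.closed by simp
      qed
    qed
    have other: "\<pi> (inj_summand (i', j) s) = \<zero>\<^bsub>S i\<^esub>"
      if ij: "i' \<in> {1..t}" "j \<in> {1..m i'}" "i' \<noteq> i" "s \<in> carrier (S i')" for i' j s
    proof -
      note h = comp[OF ij(1,2)]
      have "\<not> bij_betw (\<lambda>s. \<pi> (inj_summand (i', j) s)) (carrier (S i')) (carrier (S i))"
        using inequivalent[OF ij(1) ij0(2)] ij(3) left_module_hom.hom[OF h]
        unfolding module_isomorphic_def by blast
      then show ?thesis
        using left_module_hom.schur[OF h simple[OF ij(1)] simple[OF ij0(2)]] ij(4) by blast
    qed
    have "\<exists>c. \<forall>s\<in>carrier (S i). \<pi> (inj_summand (i, j) s) = Si.scale c s" if "j \<in> {1..m i}" for j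
      using endo[OF ij0(2) left_module_hom.hom[OF comp[OF ij0(2) that]]] .
    then have "\<forall>j\<in>{1..m i}. \<exists>c. \<forall>s\<in>carrier (S i). \<pi> (inj_summand (i, j) s) = Si.scale c s"
      by blast
    then obtain c where "\<forall>j\<in>{1..m i}. \<forall>s\<in>carrier (S i). \<pi> (inj_summand (i, j) s) = Si.scale (c j) s"
      by (rule bchoice[THEN exE])
    then have c: "\<pi> (inj_summand (i, j) s) = Si.scale (c j) s"
      if "j \<in> {1..m i}" "s \<in> carrier (S i)" for j s
      using that by blast
    have \<pi>_eq: "\<pi> x = (\<Oplus>\<^bsub>S i\<^esub>j\<in>{1..m i}. Si.scale (c j) (x (i, j)))" if x: "x \<in> carrier W" for x
    proof -
      have comp_closed: "x (i', j) \<in> carrier (S i')" if "i' \<in> {1..t}" "j \<in> {1..m i'}" for i' j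
        using component_closed[OF x, of "(i', j)"] that by simp
      have inc_closed: "inj_summand p' (x p') \<in> carrier W" if "p' \<in> (SIGMA i:{1..t}. {1..m i})" for p'
        using left_module_hom.closed[OF inj_summand_hom[OF that]] component_closed[OF x that] by blast
      have "\<pi> x = \<pi> (\<Oplus>\<^bsub>W\<^esub>p'\<in>(SIGMA i:{1..t}. {1..m i}). inj_summand p' (x p'))"
        using sum_of_components[OF x] by simp
      also have "\<dots> = (\<Oplus>\<^bsub>S i\<^esub>p'\<in>(SIGMA i:{1..t}. {1..m i}). \<pi> (inj_summand p' (x p')))"
        by (rule \<pi>.finsum) (use inc_closed in blast)
      also have "\<dots> = (\<Oplus>\<^bsub>S i\<^esub>p'\<in>Pair i ` {1..m i}. Si.scale (c (snd p')) (x p'))"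
      proof (rule Si.M.add.finprod_mono_neutral_cong_right)
        show "\<pi> (inj_summand p' (x p')) = \<zero>\<^bsub>S i\<^esub>"
          if p': "p' \<in> (SIGMA i:{1..t}. {1..m i}) - Pair i ` {1..m i}" for p'
        proof -
          obtain i' j where p'_eq: "p' = (i', j)" "i' \<in> {1..t}" "j \<in> {1..m i'}"
            using p' by blast
          then have "i' \<noteq> i"
            using p' by blast
          then show ?thesis
            using other[OF p'_eq(2,3) _ comp_closed[OF p'_eq(2,3)]] p'_eq(1) by blast
        qed
        show "\<pi> (inj_summand p' (x p')) = Si.scale (c (snd p')) (x p')"
          if p': "p' \<in> Pair i ` {1..m i}" for p'
        proof -
          obtain j where p'_eq: "p' = (i, j)" "j \<in> {1..m i}"
            using p' by blast
          then show ?thesis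
            using c[OF p'_eq(2) comp_closed[OF ij0(2) p'_eq(2)]] by simp
        qed
        show "(\<lambda>p'. \<pi> (inj_summand p' (x p'))) \<in> (SIGMA i:{1..t}. {1..m i}) \<rightarrow> carrier (S i)"
          using inc_closed \<pi>.closed by blast
      qed (use ij0(2) finite_index in auto)
      also have "\<dots> = (\<Oplus>\<^bsub>S i\<^esub>j\<in>{1..m i}. Si.scale (c (snd (i, j))) (x (i, j)))"
        by (rule Si.M.finsum_reindex) (use comp_closed ij0(2) in \<open>auto intro: inj_onI\<close>)
      finally show ?thesis
        by simp
    qed
    have "\<iota> i j0 \<in> {1..r} \<times> B i"
      using img[OF ij0(2)] ij0(3) by blast
    then obtain q b where qb: "\<iota> i j0 = (q, b)" "q \<in> {1..r}" "b \<in> B i"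
      by blast
    have "f q \<in> K"
      using K(2) qb(2) by blast
    then have "\<zero>\<^bsub>S i\<^esub> = \<pi> (f q)"
      using \<pi>_K by (simp add: ij0(1))
    also have "\<dots> = (\<Oplus>\<^bsub>S i\<^esub>j\<in>{1..m i}. Si.scale (c j) (\<Oplus>\<^bsub>S i\<^esub>b\<in>B i. Si.scale (a q i j b) b))"
      unfolding \<pi>_eq[OF f_closed]
    proof (rule Si.M.finsum_cong'[OF refl])
      show "(\<lambda>j. Si.scale (c j) (\<Oplus>\<^bsub>S i\<^esub>b\<in>B i. Si.scale (a q i j b) b)) \<in> {1..m i} \<rightarrow> carrier (S i)"
        using B[OF ij0(2)] by (auto intro!: Si.M.finsum_closed Si.scale_closed)
    qed (simp only: f_apply[OF ij0(2)])
    also have "\<dots> = (\<Oplus>\<^bsub>S i\<^esub>b\<in>B i. Si.scale (\<Sum>j\<in>{1..m i}. a q i j b * c j) b)"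
      by (rule Si.combination_of_combinations) (use B[OF ij0(2)] in auto)
    finally have "(\<Sum>j\<in>{1..m i}. a q i j b * c j) = 0"
      using indep[OF ij0(2) qb(3), of "\<lambda>b. \<Sum>j\<in>{1..m i}. a q i j b * c j"] by simp
    moreover have "(\<Sum>j\<in>{1..m i}. a q i j b * c j) = (\<Sum>j\<in>{1..m i}. if j = j0 then c j else 0)"
      by (rule sum.cong) (use qb(1) ij0(3) inj_onD[OF inj[OF ij0(2)]] in \<open>auto simp: a_def\<close>)
    ultimately have "c j0 = 0"
      using ij0(3) by simp
    moreover obtain v where v: "v \<in> carrier (S i)" "v \<noteq> \<zero>\<^bsub>S i\<^esub>"
      using simple[OF ij0(2)] Si.M.zero_closed unfolding simple_module_def by blast
    ultimately show False
      using c[OF ij0(3) v(1)] \<pi>_inc[of v] by (simp add: ij0(1))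
  qed
  moreover have "f ` {1..r} \<subseteq> carrier W"
    using f_closed by auto
  ultimately have "generated_submodule KG W (f ` {1..r}) = carrier W"
    using W.generated_submodule_eq_carrier_iff by blast
  then show ?thesis
    unfolding r_generated_def using f_closed by blast
qed

end

section \<open>The trivial module and the least number of generators\<close>

text \<open>
  The line \<open>k\<close> on which all group elements act as the identity, so that \<open>a\<close> in \<open>kG\<close> acts through its
  augmentation. It serves to show that there is at least one simple module, without which the maximum
  in the theorem would be taken over the empty set.
\<close>

definition trivial_module :: "('g, 'c) monoid_scheme \<Rightarrow> ('g \<Rightarrow> 'k :: field, 'k) module"
  where "trivial_module G =
    \<lparr>carrier = UNIV, mult = (*), one = 1, zero = 0, add = (+),
     smult = (\<lambda>a x. (\<Sum>g\<in>carrier G. a g) * x)\<rparr>"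

lemma augmentation_mult:
  fixes G :: "('g, 'c) monoid_scheme" and a b :: "'g \<Rightarrow> 'k :: field"
  assumes "group G"
  shows "(\<Sum>g\<in>carrier G. (a \<otimes>\<^bsub>group_algebra G\<^esub> b) g) = (\<Sum>g\<in>carrier G. a g) * (\<Sum>g\<in>carrier G. b g)"
proof -
  interpret G: group G by fact
  have translate: "(\<Sum>g\<in>carrier G. b (inv\<^bsub>G\<^esub> h \<otimes>\<^bsub>G\<^esub> g)) = (\<Sum>g\<in>carrier G. b g)" if h: "h \<in> carrier G" for h
    by (rule sum.reindex_bij_witness[of _ "\<lambda>y. h \<otimes>\<^bsub>G\<^esub> y" "\<lambda>g. inv\<^bsub>G\<^esub> h \<otimes>\<^bsub>G\<^esub> g"])
      (use h in \<open>simp_all add: G.m_assoc[symmetric]\<close>)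
  have "(\<Sum>g\<in>carrier G. (a \<otimes>\<^bsub>group_algebra G\<^esub> b) g) =
      (\<Sum>g\<in>carrier G. \<Sum>h\<in>carrier G. a h * b (inv\<^bsub>G\<^esub> h \<otimes>\<^bsub>G\<^esub> g))"
    by (rule sum.cong) (simp_all add: group_algebra_def)
  also have "\<dots> = (\<Sum>h\<in>carrier G. \<Sum>g\<in>carrier G. a h * b (inv\<^bsub>G\<^esub> h \<otimes>\<^bsub>G\<^esub> g))"
    by (rule sum.swap)
  also have "\<dots> = (\<Sum>h\<in>carrier G. a h * (\<Sum>g\<in>carrier G. b g))"
    by (rule sum.cong) (simp_all add: translate flip: sum_distrib_left)
  finally show ?thesis
    by (simp add: sum_distrib_right)
qed

lemma trivial_module_simple:
  fixes G :: "('g, 'c) monoid_scheme"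
  assumes G: "group G" "finite (carrier G)"
  shows "simple_module (group_algebra G :: ('g \<Rightarrow> 'k :: field) ring) (trivial_module G)"
proof -
  interpret G: group G by fact
  let ?R = "group_algebra G :: ('g \<Rightarrow> 'k) ring" and ?T = "trivial_module G :: ('g \<Rightarrow> 'k, 'k) module"
  have sel: "carrier ?T = UNIV" "\<zero>\<^bsub>?T\<^esub> = 0" "x \<oplus>\<^bsub>?T\<^esub> y = x + y"
    "a \<odot>\<^bsub>?T\<^esub> x = (\<Sum>g\<in>carrier G. a g) * x" for a x y
    by (simp_all add: trivial_module_def)
  have scalar: "(\<Sum>g\<in>carrier G. (if g = \<one>\<^bsub>G\<^esub> then c else 0)) = c" for c :: 'k
    using G(2) by simp
  have "abelian_group ?T"
  proof (rule abelian_groupI)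
    show "\<exists>y\<in>carrier ?T. y \<oplus>\<^bsub>?T\<^esub> x = \<zero>\<^bsub>?T\<^esub>" if "x \<in> carrier ?T" for x
      by (rule bexI[of _ "- x"]) (simp_all add: sel)
  qed (simp_all add: sel add_ac)
  then interpret T: left_module ?R ?T
  proof (intro left_module.intro left_module_axioms.intro group_algebra_ring[OF G])
    show "(a \<otimes>\<^bsub>?R\<^esub> b) \<odot>\<^bsub>?T\<^esub> x = a \<odot>\<^bsub>?T\<^esub> (b \<odot>\<^bsub>?T\<^esub> x)" for a b x
      by (simp add: sel augmentation_mult[OF G(1)])
    show "\<one>\<^bsub>?R\<^esub> \<odot>\<^bsub>?T\<^esub> x = x" for x
      using scalar[of 1] by (simp add: sel group_algebra_def)
    show "(a \<oplus>\<^bsub>?R\<^esub> b) \<odot>\<^bsub>?T\<^esub> x = a \<odot>\<^bsub>?T\<^esub> x \<oplus>\<^bsub>?T\<^esub> b \<odot>\<^bsub>?T\<^esub> x" for a b x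
      by (simp add: sel group_algebra_def sum.distrib distrib_right)
  qed (simp_all add: sel distrib_left)
  have "N = {0} \<or> N = UNIV" if N: "Module.submodule N ?R ?T" for N
  proof (rule disjCI)
    assume "N \<noteq> UNIV"
    have "x = 0" if x: "x \<in> N" for x
    proof (rule ccontr)
      assume "x \<noteq> 0"
      have "y \<in> N" for y
      proof -
        let ?a = "\<lambda>g. if g = \<one>\<^bsub>G\<^esub> then y / x else 0"
        have "?a \<in> carrier ?R"
          by (auto simp: group_algebra_def)
        then have "?a \<odot>\<^bsub>?T\<^esub> x \<in> N"
          using N x unfolding T.submodule_iff by blast
        then show ?thesis
          using \<open>x \<noteq> 0\<close> by (simp add: sel scalar)
      qed
      then show False
        using \<open>N \<noteq> UNIV\<close> by blast
    qed
    moreover have "0 \<in> N"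
      using N unfolding T.submodule_iff by (simp add: sel)
    ultimately show "N = {0}"
      by blast
  qed
  moreover have "(UNIV :: 'k set) \<noteq> {0}"
    by (metis UNIV_I one_neq_zero singletonD)
  ultimately show ?thesis
    unfolding simple_module_def using T.left_module_axioms by (simp add: sel)
qed

lemma complete_simple_reps_nonempty:
  fixes G :: "('g, 'c) monoid_scheme"
    and S :: "nat \<Rightarrow> ('g \<Rightarrow> 'k :: field, 'w, 'd) module_scheme"
  assumes "group G" "finite (carrier G)" "complete_simple_reps (group_algebra G) t S"
  shows "0 < t"
proof -
  obtain N :: "('g \<Rightarrow> 'k, 'g \<Rightarrow> 'k) module" where "simple_module (group_algebra G) N"
    using simple_module_in_ring_type[OF trivial_module_simple[OF assms(1,2)]] by blast
  then have "\<exists>i\<in>{1..t}. module_isomorphic (group_algebra G) N (S i)"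
    using assms(3) unfolding complete_simple_reps_def by blast
  then show ?thesis
    by auto
qed

text \<open>
  The conditions \<open>m\<^sub>i \<le> r d\<^sub>i\<close> together say that \<open>r\<close> is at least the maximum of the
  \<open>m\<^sub>i / d\<^sub>i\<close>, equivalently at least its ceiling.
\<close>

lemma least_multiple_bound:
  fixes m d :: "nat \<Rightarrow> nat"
  assumes I: "finite I" "I \<noteq> {}" and d: "\<And>i. i \<in> I \<Longrightarrow> d i > 0"
    and P: "\<And>r. P r \<longleftrightarrow> (\<forall>i\<in>I. m i \<le> r * d i)"
  shows "\<exists>r. int r = \<lceil>Max {real (m i) / real (d i) | i. i \<in> I}\<rceil> \<and> P r \<and> (\<forall>r'. P r' \<longrightarrow> r \<le> r')"
proof -
  let ?Q = "{real (m i) / real (d i) | i. i \<in> I}"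
  have Q: "?Q = (\<lambda>i. real (m i) / real (d i)) ` I"
    by auto
  have "m i \<le> r * d i \<longleftrightarrow> real (m i) / real (d i) \<le> real r" if "i \<in> I" for i r
    using d[OF that] by (simp add: pos_divide_le_eq flip: of_nat_mult)
  then have "P r \<longleftrightarrow> Max ?Q \<le> real r" for r
    unfolding Q using I by (simp add: P)
  then have P_iff: "P r \<longleftrightarrow> \<lceil>Max ?Q\<rceil> \<le> int r" for r
    by (simp add: ceiling_le_iff)
  obtain i where i: "i \<in> I"
    using I by blast
  have "0 \<le> real (m i) / real (d i)"
    by simp
  also have "\<dots> \<le> Max ?Q"
    unfolding Q using I i by (intro Max_ge) auto
  finally have "0 \<le> \<lceil>Max ?Q\<rceil>"
    by simp
  then have "int (nat \<lceil>Max ?Q\<rceil>) = \<lceil>Max ?Q\<rceil>"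
    by simp
  then show ?thesis
    by (intro exI[of _ "nat \<lceil>Max ?Q\<rceil>"]) (simp add: P_iff nat_le_iff)
qed

theorem theorem2p4:
  fixes n t :: nat
    and V :: "((nat \<Rightarrow> nat) \<Rightarrow> 'k :: field, 'v) module"
    and S :: "nat \<Rightarrow> ((nat \<Rightarrow> nat) \<Rightarrow> 'k, 'w) module"
    and m :: "nat \<Rightarrow> nat"
  assumes "infinite (UNIV :: 'k set)"
    and "CHAR('k) = 0 \<or> CHAR('k) > n"
    and "left_module (group_algebra (sym_group n)) V"
    and "finitely_generated (group_algebra (sym_group n)) V"
    and "complete_simple_reps (group_algebra (sym_group n)) t S"
    and "module_isomorphic (group_algebra (sym_group n)) V (isotypic_sum t m S)"
  shows "(\<forall>r. r_generated (group_algebra (sym_group n)) r V \<longleftrightarrow>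
             (\<forall>i \<in> {1..t}. m i \<le> r * module_dim (sym_group n) (S i))) \<and>
         (\<exists>r. int r = \<lceil>Max {real (m i) / real (module_dim (sym_group n) (S i)) | i. i \<in> {1..t}}\<rceil> \<and>
              r_generated (group_algebra (sym_group n)) r V \<and>
              (\<forall>r'. r_generated (group_algebra (sym_group n)) r' V \<longrightarrow> r \<le> r'))"
proof -
  let ?G = "sym_group n"
  let ?R = "group_algebra ?G :: ((nat \<Rightarrow> nat) \<Rightarrow> 'k) ring"
  have group: "group ?G"
    by (rule sym_group_is_group)
  have finite: "finite (carrier ?G)"
    by (simp add: sym_group_def finite_permutations)
  have simple: "simple_module ?R (S i)" if "i \<in> {1..t}" for i
    using assms(5) that unfolding complete_simple_reps_def by blast
  have inequivalent: "i = j"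
    if "i \<in> {1..t}" "j \<in> {1..t}" "module_isomorphic ?R (S i) (S j)" for i j
    using assms(5) that unfolding complete_simple_reps_def by blast
  interpret isotypic_decomposition ?G t m S
    by (intro isotypic_decomposition.intro isotypic_decomposition_axioms.intro group finite simple)
  have symmetric: "symmetric_group_module n (S i)" if "i \<in> {1..t}" for i
    by (intro symmetric_group_module.intro symmetric_group_module_axioms.intro
        simple_group_module that assms(2))
  have endo: "\<exists>c. \<forall>x\<in>carrier (S i). h x = group_algebra_module.scale ?G (S i) c x"
    if i: "i \<in> {1..t}" and h: "h \<in> module_hom ?R (S i) (S i)" for i h
    by (rule symmetric_group_module.endomorphism_scalar[OF symmetric[OF i] simple[OF i] h])
  have criterion: "r_generated ?R r V \<longleftrightarrow> (\<forall>i \<in> {1..t}. m i \<le> r * module_dim ?G (S i))" for r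
  proof -
    have "r_generated ?R r V \<longleftrightarrow> r_generated ?R r W"
      using assms(3,6) W.left_module_axioms unfolding isotypic_sum_eq by (intro r_generated_cong)
    moreover have "r_generated ?R r W \<longleftrightarrow> (\<forall>i \<in> {1..t}. m i \<le> r * module_dim ?G (S i))"
      using generated_imp_multiplicity_le multiplicity_le_imp_generated[OF endo inequivalent] by blast
    ultimately show ?thesis
      by simp
  qed
  have "0 < t"
    by (rule complete_simple_reps_nonempty[OF group finite assms(5)])
  then have nonempty: "{1..t} \<noteq> {}"
    by simp
  have dim_pos: "0 < module_dim ?G (S i)" if "i \<in> {1..t}" for i
    using group_algebra_module.simple_module_dim_pos[OF simple_group_module[OF that] simple[OF that]] .
  have "\<exists>r. int r = \<lceil>Max {real (m i) / real (module_dim ?G (S i)) | i. i \<in> {1..t}}\<rceil> \<and>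
      r_generated ?R r V \<and> (\<forall>r'. r_generated ?R r' V \<longrightarrow> r \<le> r')"
    by (rule least_multiple_bound[OF finite_atLeastAtMost nonempty dim_pos criterion])
  with criterion show ?thesis
    by (intro conjI allI)
qed

end
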